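(* Let $F$ be the modular form of weight one on $G_3[\sqrt{-3}]$ (with some character $v$) that vanishes along the three mirrors $w_1=0$, $w_2=0$, $w_3=0$ (and whose zero divisor consists exactly of their $G_3[\sqrt{-3}]$-orbits, with multiplicity one). Then for every $a\in\mathcal{E}^4$ with $h(a,a)=-1$, the value $v(\gamma)$ on the triflection $\gamma$ along $a$ is $\zeta$ if $a$ is congruent modulo $\sqrt{-3}$ to one of $\pm(0,1,0,0)$, $\pm(0,0,1,0)$, $\pm(0,0,0,1)$, and is $1$ otherwise.
   Context: $\zeta=(-1+\sqrt{-3})/2$, $\mathcal{E}=\mathbb{Z}[\zeta]$. On $\mathbb{C}^4$ (coordinates $z_0,\dots,z_3$), $h(z,w)=\bar z_0w_0-\bar z_1w_1-\bar z_2w_2-\bar z_3w_3$; $G_3$ is the group of $h$-unitary matrices in $\mathrm{GL}(4,\mathcal{E})$, $G_3[\sqrt{-3}]$ the kernel of reduction modulo $\sqrt{-3}$. $\tilde{\mathcal B}=\{z:h(z,z)>0\}$, identified projectively with the ball via $w_i=z_i/z_0$. A modular form of weight $k$ on $\Gamma$ with character $v$: holomorphic $f$ on $\tilde{\mathcal B}$ with $f(tz)=t^{-k}f(z)$, $f(\gamma z)=v(\gamma)f(z)$, regular at cusps. Such an $F$ of weight one as described exists. For $b\in\mathcal{E}^4$ with $h(b,b)=-1$, the triflection along $b$ is $x\mapsto x-(1-\zeta)\frac{h(b,x)}{h(b,b)}b$; it lies in $G_3[\sqrt{-3}]$. *)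

theory Defs
  imports "HOL-Analysis.Analysis"
begin

definition zeta :: complex where
  "zeta = Complex (-1/2) (sqrt 3 / 2)"

definition s3 :: complex where
  "s3 = \<i> * complex_of_real (sqrt 3)"

definition Eis :: "complex set" where
  "Eis = {of_int a + of_int b * zeta | a b. True}"

definition cong_s3 :: "complex \<Rightarrow> complex \<Rightarrow> bool" where
  "cong_s3 x y \<longleftrightarrow> (\<exists>e\<in>Eis. x - y = s3 * e)"

definition heps :: "4 \<Rightarrow> complex" where
  "heps j = (if j = 0 then 1 else -1)"

definition herm :: "complex^4 \<Rightarrow> complex^4 \<Rightarrow> complex" where
  "herm z w = (\<Sum>j\<in>UNIV. heps j * cnj (z$j) * w$j)"

definition Bt :: "(complex^4) set" where
  "Bt = {z. Re (herm z z) > 0}"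

definition Evec :: "(complex^4) set" where
  "Evec = {a. \<forall>i. a$i \<in> Eis}"

definition G3 :: "(complex^4^4) set" where
  "G3 = {M. (\<forall>i j. M$i$j \<in> Eis)
          \<and> (\<exists>N. (\<forall>i j. N$i$j \<in> Eis) \<and> M ** N = mat 1)
          \<and> (\<forall>z w. herm (M *v z) (M *v w) = herm z w)}"

definition G3s3 :: "(complex^4^4) set" where
  "G3s3 = {M \<in> G3. \<forall>i j. cong_s3 (M$i$j) (mat 1 $i$j)}"

text \<open>Triflection along b: x \<mapsto> x - (1-zeta) h(b,x)/h(b,b) b, as a matrix.\<close>
definition triflection :: "complex^4 \<Rightarrow> complex^4^4" where
  "triflection b = (\<chi> i j. (mat 1 :: complex^4^4)$i$j
        - (1 - zeta) * (heps j * cnj (b$j)) / herm b b * b$i)"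

definition cderiv_at :: "(complex^4 \<Rightarrow> complex) \<Rightarrow> complex^4 \<Rightarrow> complex^4 \<Rightarrow> bool" where
  "cderiv_at f z c \<longleftrightarrow> (f has_derivative (\<lambda>x. \<Sum>j\<in>UNIV. c$j * x$j)) (at z)"

definition holo4_on :: "(complex^4 \<Rightarrow> complex) \<Rightarrow> (complex^4) set \<Rightarrow> bool" where
  "holo4_on f S \<longleftrightarrow> (\<forall>z\<in>S. \<exists>c. cderiv_at f z c)"

text \<open>Modular form of weight k on Gamma with character v (regularity at cusps omitted:
  automatic by the Koecher principle, the ball having dimension 3).\<close>
definition modular_form :: "nat \<Rightarrow> (complex^4^4) set \<Rightarrow> (complex^4^4 \<Rightarrow> complex)
      \<Rightarrow> (complex^4 \<Rightarrow> complex) \<Rightarrow> bool" where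
  "modular_form k \<Gamma> v f \<longleftrightarrow>
     holo4_on f Bt
   \<and> (\<forall>z\<in>Bt. \<forall>t::complex. t \<noteq> 0 \<longrightarrow> f (t *s z) = inverse (t ^ k) * f z)
   \<and> (\<forall>\<gamma>\<in>\<Gamma>. \<forall>z\<in>Bt. f (\<gamma> *v z) = v \<gamma> * f z)"

end

theory Submission
  imports Defs
begin

text \<open>
The triflection along \<open>a\<close> fixes the mirror \<open>h(a, z) = 0\<close> pointwise, so \<open>v\<close> takes the value 1 on it
unless \<open>F\<close> vanishes on the whole mirror. If it does, a generic point of the mirror lies on a mirror
of some \<open>\<gamma> e\<^sub>k\<close>; since there are only countably many of these, \<open>a\<close> is a unit multiple of \<open>\<gamma> e\<^sub>k\<close>,
hence \<open>a \<equiv> \<plusminus>e\<^sub>k\<close> modulo \<open>\<surd>-3\<close>.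

Conversely, all lattice vectors of norm -1 are equivalent under \<open>G\<^sub>3\<close>: reflections of order 6
decrease \<open>|h(\<rho>, a)|\<close> for the isotropic vector \<open>\<rho> = (1, 1, 0, 0)\<close>. If moreover \<open>a \<equiv> \<plusminus>e\<^sub>k\<close>, then because
the stabilizer of \<open>e\<^sub>k\<close> in \<open>G\<^sub>3\<close> surjects onto its analogue over the field with three elements, \<open>a\<close> is
even of the form \<open>\<plusminus>\<gamma> e\<^sub>k\<close> with \<open>\<gamma>\<close> in the congruence subgroup. So \<open>F\<close> vanishes on the mirror of \<open>a\<close>,
to first order, and comparing the normal derivatives of both sides of \<open>F(\<gamma>\<^sub>a z) = v(\<gamma>\<^sub>a) F(z)\<close>
gives \<open>v(\<gamma>\<^sub>a) = \<zeta>\<close>.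
\<close>

section \<open>Eisenstein integers\<close>

lemma Eis_iff: "x \<in> Eis \<longleftrightarrow> (\<exists>a b. x = of_int a + of_int b * zeta)"
  by (auto simp: Eis_def)

lemma zeta_squared: "zeta * zeta = -1 - zeta"
  by (simp add: zeta_def complex_eq_iff)

lemma cnj_zeta: "cnj zeta = -1 - zeta"
  by (simp add: zeta_def complex_eq_iff)

lemma s3_eq: "s3 = 1 + 2 * zeta"
  by (simp add: zeta_def s3_def complex_eq_iff)

lemma s3_squared: "s3 * s3 = -3"
  by (simp add: s3_def complex_eq_iff)

lemma unit_cnj_mult: "cmod u = 1 \<Longrightarrow> cnj u * u = 1"
  using complex_norm_square[of u] by (simp add: mult.commute)

lemma cnj_s3: "cnj s3 = - s3"
  by (simp add: s3_def)

lemma Eis_of_int [simp, intro]: "of_int n \<in> Eis"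
  unfolding Eis_iff by (rule exI[of _ n], rule exI[of _ 0]) simp

lemma Eis_0 [simp, intro]: "0 \<in> Eis" and Eis_1 [simp, intro]: "1 \<in> Eis"
  and Eis_numeral [simp, intro]: "numeral w \<in> Eis"
  using Eis_of_int[of 0] Eis_of_int[of 1] Eis_of_int[of "numeral w"] by simp_all

lemma Eis_zeta [simp, intro]: "zeta \<in> Eis"
  unfolding Eis_iff by (rule exI[of _ 0], rule exI[of _ 1]) simp

lemma Eis_add [simp, intro]: assumes "x \<in> Eis" "y \<in> Eis" shows "x + y \<in> Eis"
proof -
  obtain a b c d where "x = of_int a + of_int b * zeta" "y = of_int c + of_int d * zeta"
    using assms unfolding Eis_iff by blast
  then have "x + y = of_int (a + c) + of_int (b + d) * zeta" by (simp add: algebra_simps)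
  then show ?thesis unfolding Eis_iff by blast
qed

lemma Eis_uminus [simp, intro]: assumes "x \<in> Eis" shows "- x \<in> Eis"
proof -
  obtain a b where "x = of_int a + of_int b * zeta"
    using assms unfolding Eis_iff by blast
  then have "- x = of_int (- a) + of_int (- b) * zeta" by (simp add: algebra_simps)
  then show ?thesis unfolding Eis_iff by blast
qed

lemma Eis_diff [simp, intro]: "x \<in> Eis \<Longrightarrow> y \<in> Eis \<Longrightarrow> x - y \<in> Eis"
  using Eis_add[of x "- y"] by simp

lemma Eis_mult [simp, intro]: assumes "x \<in> Eis" "y \<in> Eis" shows "x * y \<in> Eis"
proof -
  obtain a b c d where xy: "x = of_int a + of_int b * zeta" "y = of_int c + of_int d * zeta"
    using assms unfolding Eis_iff by blast
  have "x * y = of_int a * of_int c + (of_int a * of_int d + of_int b * of_int c) * zeta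
      + of_int b * of_int d * (zeta * zeta)"
    unfolding xy by (simp add: algebra_simps)
  also have "\<dots> = of_int (a * c - b * d) + of_int (a * d + b * c - b * d) * zeta"
    unfolding zeta_squared by (simp add: algebra_simps)
  finally show ?thesis unfolding Eis_iff by blast
qed

lemma Eis_s3 [simp, intro]: "s3 \<in> Eis"
  unfolding s3_eq by blast

lemma Eis_cnj [simp, intro]: assumes "x \<in> Eis" shows "cnj x \<in> Eis"
proof -
  obtain a b where "x = of_int a + of_int b * zeta"
    using assms unfolding Eis_iff by blast
  then have "cnj x = of_int a + of_int b * cnj zeta" by simp
  then show ?thesis by (simp add: cnj_zeta)
qed

lemma Eis_sum [simp, intro]: "(\<And>i. i \<in> A \<Longrightarrow> f i \<in> Eis) \<Longrightarrow> sum f A \<in> Eis"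
  by (induction A rule: infinite_finite_induct) auto

lemma countable_Eis: "countable Eis"
proof -
  have "Eis = (\<lambda>(a, b). of_int a + of_int b * zeta) ` UNIV"
    by (auto simp: Eis_def)
  then show ?thesis by (metis countable_image countableI_type)
qed

text \<open>The squared modulus is the form \<open>a * a - a * b + b * b\<close>, an integer. Its
  values serve as the measure in the later induction.\<close>

lemma Eis_norm: assumes "x \<in> Eis" obtains n :: nat where "(cmod x)\<^sup>2 = real n"
proof -
  obtain a b where "x = of_int a + of_int b * zeta"
    using assms unfolding Eis_iff by blast
  then have "(cmod x)\<^sup>2 = (of_int a - of_int b / 2)\<^sup>2 + (of_int b * (sqrt 3 / 2))\<^sup>2"
    by (simp add: cmod_power2 zeta_def)
  also have "\<dots> = of_int (a * a - a * b + b * b)"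
    by (simp add: power2_eq_square algebra_simps)
  finally have *: "(cmod x)\<^sup>2 = of_int (a * a - a * b + b * b)" .
  then have "a * a - a * b + b * b \<ge> 0"
    by (metis of_int_0_le_iff zero_le_power2)
  then have "(cmod x)\<^sup>2 = real (nat (a * a - a * b + b * b))" using * by simp
  then show ?thesis using that by blast
qed

text \<open>Rounding leaves an error of at most \<open>sqrt 3 / 4\<close> in the imaginary part and
  1/2 in the real part, and 3/16 + 1/4 = 7/16. What matters is that 7/16 is below 1/2: two
  coordinates approximated together then have total squared error below 1.\<close>

lemma Eis_approx:
  obtains e where "e \<in> Eis" "(cmod (z - e))\<^sup>2 \<le> 7/16"
proof -
  \<comment> \<open>The imaginary part of \<open>e\<close> depends on \<open>q\<close> alone, so
    \<open>q\<close> is fixed first; \<open>p\<close> then absorbs the shift by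
    \<open>- q / 2\<close> that \<open>q * zeta\<close> causes in the real part.\<close>
  define q where "q = round (2 * Im z / sqrt 3)"
  define p where "p = round (Re z + of_int q / 2)"
  define e where "e = of_int p + of_int q * zeta"
  have "\<bar>of_int q - 2 * Im z / sqrt 3\<bar> \<le> 1/2" unfolding q_def by (rule of_int_round_abs_le)
  then have "(of_int q - 2 * Im z / sqrt 3)\<^sup>2 \<le> (1/2)\<^sup>2" by (metis abs_le_square_iff abs_of_nonneg zero_le_divide_1_iff zero_le_numeral)
  then have "(3/4) * (of_int q - 2 * Im z / sqrt 3)\<^sup>2 \<le> 3/16" by (simp add: power2_eq_square)
  moreover have "(3/4) * (of_int q - 2 * Im z / sqrt 3)\<^sup>2 = (Im (z - e))\<^sup>2"
  proof -
    have "Im (z - e) = - (sqrt 3 / 2) * (of_int q - 2 * Im z / sqrt 3)"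
      by (simp add: e_def zeta_def field_simps)
    then show ?thesis by (simp only: power_mult_distrib) (simp add: power_divide)
  qed
  moreover have "\<bar>of_int p - (Re z + of_int q / 2)\<bar> \<le> 1/2" unfolding p_def by (rule of_int_round_abs_le)
  then have "(of_int p - (Re z + of_int q / 2))\<^sup>2 \<le> (1/2)\<^sup>2" by (metis abs_le_square_iff abs_of_nonneg zero_le_divide_1_iff zero_le_numeral)
  moreover have "(of_int p - (Re z + of_int q / 2))\<^sup>2 = (Re (z - e))\<^sup>2"
    by (simp add: e_def zeta_def power2_eq_square algebra_simps)
  ultimately have "(cmod (z - e))\<^sup>2 \<le> 7/16" by (simp only: cmod_power2) (simp add: power2_eq_square)
  moreover have "e \<in> Eis" by (auto simp: e_def)
  ultimately show ?thesis using that by blast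
qed

section \<open>Congruence modulo the prime \<open>s3\<close>\<close>

lemma cong_s3_refl [simp, intro]: "cong_s3 x x"
  unfolding cong_s3_def by (rule bexI[of _ 0]) auto

lemma cong_s3_sym: assumes "cong_s3 x y" shows "cong_s3 y x"
proof -
  obtain e where "e \<in> Eis" "x - y = s3 * e" using assms by (auto simp: cong_s3_def)
  then have "- e \<in> Eis" "y - x = s3 * (- e)" by (auto simp: algebra_simps)
  then show ?thesis unfolding cong_s3_def by blast
qed

lemma cong_s3_add [intro]: assumes "cong_s3 x y" "cong_s3 x' y'" shows "cong_s3 (x + x') (y + y')"
proof -
  obtain e e' where "e \<in> Eis" "x - y = s3 * e" "e' \<in> Eis" "x' - y' = s3 * e'"
    using assms by (auto simp: cong_s3_def)
  then have "e + e' \<in> Eis" "x + x' - (y + y') = s3 * (e + e')" by (auto simp: algebra_simps)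
  then show ?thesis unfolding cong_s3_def by blast
qed

lemma cong_s3_mult_left [intro]: assumes "cong_s3 x y" "c \<in> Eis" shows "cong_s3 (c * x) (c * y)"
proof -
  obtain e where "e \<in> Eis" "x - y = s3 * e" using assms by (auto simp: cong_s3_def)
  then have "c * e \<in> Eis" "c * x - c * y = s3 * (c * e)" using assms by (auto simp: algebra_simps)
  then show ?thesis unfolding cong_s3_def by blast
qed

lemma cong_s3_trans [trans]: assumes "cong_s3 x y" "cong_s3 y z" shows "cong_s3 x z"
proof -
  obtain e e' where "e \<in> Eis" "x - y = s3 * e" "e' \<in> Eis" "y - z = s3 * e'"
    using assms by (auto simp: cong_s3_def)
  then have "e + e' \<in> Eis" "x - z = s3 * (e + e')" by (auto simp: algebra_simps)
  then show ?thesis unfolding cong_s3_def by blast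
qed

lemma cong_s3_cnj [intro]: assumes "cong_s3 x y" shows "cong_s3 (cnj x) (cnj y)"
proof -
  obtain e where e: "e \<in> Eis" "x - y = s3 * e" using assms by (auto simp: cong_s3_def)
  have "cnj x - cnj y = cnj (x - y)" by simp
  also have "\<dots> = s3 * (- cnj e)" unfolding e by (simp add: cnj_s3)
  finally show ?thesis unfolding cong_s3_def using e by blast
qed

lemma cong_s3_mult: assumes "cong_s3 x y" "cong_s3 x' y'" "x \<in> Eis" "y' \<in> Eis"
  shows "cong_s3 (x * x') (y * y')"
  using cong_s3_mult_left[OF assms(2,3)] cong_s3_mult_left[OF assms(1,4)]
  by (metis cong_s3_trans mult.commute)

lemma cong_s3_sum [intro]: "(\<And>i. i \<in> A \<Longrightarrow> cong_s3 (f i) (g i)) \<Longrightarrow> cong_s3 (sum f A) (sum g A)"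
  by (induction A rule: infinite_finite_induct) auto

text \<open>Taking squared moduli in \<open>r = s3 * e\<close> gives an equation in the integers,
  r^2 = 3 n, to which primality of 3 applies.\<close>

lemma cong_s3_of_int_0: assumes "cong_s3 (of_int r) 0" shows "3 dvd r"
proof -
  obtain e where e: "e \<in> Eis" "of_int r = s3 * e" using assms by (auto simp: cong_s3_def)
  obtain n :: nat where n: "(cmod e)\<^sup>2 = real n" using Eis_norm[OF e(1)] by blast
  have "(cmod (of_int r))\<^sup>2 = 3 * (cmod e)\<^sup>2"
    unfolding e by (simp add: norm_mult power_mult_distrib s3_def)
  then have "of_int (r\<^sup>2) = (of_int (3 * int n) :: real)" using n by simp
  then have "r\<^sup>2 = 3 * int n" by (simp only: of_int_eq_iff)
  then have "3 dvd r\<^sup>2" by simp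
  moreover have "prime (3::int)" by simp
  ultimately show ?thesis using prime_dvd_power_int by blast
qed

lemma cong_s3_of_int: assumes "3 dvd r - r'" shows "cong_s3 (of_int r) (of_int r')"
proof -
  obtain q where "r - r' = 3 * q" using assms by blast
  then have "(of_int r - of_int r' :: complex) = 3 * of_int q"
    by (metis of_int_diff of_int_mult of_int_numeral)
  also have "\<dots> = s3 * (- s3 * of_int q)" using s3_squared by algebra
  finally show ?thesis unfolding cong_s3_def by blast
qed

text \<open>The cofactor is the unit zeta^2, so \<open>1 - zeta\<close> and \<open>s3\<close> are
  associates. In particular \<open>zeta\<close> is congruent to 1.\<close>

lemma one_minus_zeta: "1 - zeta = s3 * (-1 - zeta)"
  unfolding s3_eq using zeta_squared by algebra

lemma Eis_residue: assumes "x \<in> Eis" obtains r :: int where "r \<in> {-1, 0, 1}" "cong_s3 x (of_int r)"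
proof -
  obtain a b where x: "x = of_int a + of_int b * zeta"
    using assms unfolding Eis_iff by blast
  have "x - of_int (a + b) = - of_int b * (1 - zeta)" unfolding x by (simp add: algebra_simps)
  also have "\<dots> = s3 * (- of_int b * (-1 - zeta))" unfolding one_minus_zeta by (simp add: algebra_simps)
  finally have 1: "cong_s3 x (of_int (a + b))" unfolding cong_s3_def by blast
  \<comment> \<open>Shifting by one before and after \<open>mod\<close> selects the representative
    in -1, 0, 1 instead of 0, 1, 2.\<close>
  define r where "r = (a + b + 1) mod 3 - 1"
  have "r \<in> {-1, 0, 1}" unfolding r_def by auto
  moreover have "3 dvd (a + b) - r" unfolding r_def by presburger
  then have "cong_s3 x (of_int r)" using 1 cong_s3_of_int cong_s3_trans by blast
  ultimately show ?thesis using that by blast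
qed

section \<open>The Hermitian lattice and its unitary group\<close>

lemma UNIV_4': "UNIV = {0, 1, 2, 3 :: 4}"
  using UNIV_4 by (auto simp: insert_commute)

lemma sum_4': "(\<Sum>i\<in>UNIV. f (i::4)) = f 0 + f 1 + f 2 + f 3"
  unfolding UNIV_4' by (simp add: add.assoc)

lemma forall_4': "(\<forall>i::4. P i) \<longleftrightarrow> P 0 \<and> P 1 \<and> P 2 \<and> P 3"
  using UNIV_4' by (metis UNIV_I insertE singletonD)

lemma herm_expand:
  "herm z w = cnj (z$0) * w$0 - cnj (z$1) * w$1 - cnj (z$2) * w$2 - cnj (z$3) * w$3"
  unfolding herm_def sum_4' by (simp add: heps_def)

lemma herm_add_left: "herm (x + y) z = herm x z + herm y z"
  and herm_add_right: "herm z (x + y) = herm z x + herm z y"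
  and herm_diff_left: "herm (x - y) z = herm x z - herm y z"
  and herm_diff_right: "herm z (x - y) = herm z x - herm z y"
  and herm_scale_left: "herm (c *s x) z = cnj c * herm x z"
  and herm_scale_right: "herm z (c *s x) = c * herm z x"
  unfolding herm_expand by (simp_all add: algebra_simps)

lemmas herm_linear = herm_add_left herm_add_right herm_diff_left herm_diff_right
  herm_scale_left herm_scale_right

lemma cnj_herm: "cnj (herm x y) = herm y x"
  unfolding herm_expand by (simp add: algebra_simps)

lemma heps_squared [simp]: "heps k * heps k = 1"
  by (simp add: heps_def)

lemma Eis_heps [simp, intro]: "heps k \<in> Eis"
  by (simp add: heps_def)

lemma cnj_heps [simp]: "cnj (heps k) = heps k"
  by (simp add: heps_def)

lemma herm_axis_left: "herm (axis k c) x = heps k * cnj c * x$k"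
proof -
  have "herm (axis k c) x = (\<Sum>j\<in>UNIV. if j = k then heps k * cnj c * x$k else 0)"
    unfolding herm_def by (rule sum.cong) (auto simp: axis_def)
  then show ?thesis by simp
qed

lemma herm_axis_right: "herm x (axis k c) = heps k * cnj (x$k) * c"
  by (subst cnj_herm[symmetric]) (simp add: herm_axis_left)

lemma herm_self: "herm x x = of_real ((cmod (x$0))\<^sup>2 - (cmod (x$1))\<^sup>2 - (cmod (x$2))\<^sup>2 - (cmod (x$3))\<^sup>2)"
  unfolding herm_expand of_real_diff complex_norm_square by (simp only: mult.commute)

lemma Evec_scale [simp, intro]: "c \<in> Eis \<Longrightarrow> x \<in> Evec \<Longrightarrow> c *s x \<in> Evec"
  and Evec_diff [simp, intro]: "x \<in> Evec \<Longrightarrow> y \<in> Evec \<Longrightarrow> x - y \<in> Evec"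
  and Evec_axis [simp, intro]: "c \<in> Eis \<Longrightarrow> axis k c \<in> Evec"
  by (auto simp: Evec_def axis_def)

lemma Evec_nth [intro]: "x \<in> Evec \<Longrightarrow> x$i \<in> Eis"
  by (simp add: Evec_def)

lemma Eis_herm [simp, intro]: "x \<in> Evec \<Longrightarrow> y \<in> Evec \<Longrightarrow> herm x y \<in> Eis"
  unfolding herm_def by (intro Eis_sum Eis_mult Eis_heps Eis_cnj Evec_nth)

lemma countable_Evec: "countable Evec"
proof -
  have "Evec \<subseteq> (\<lambda>(a, b, c, d). \<chi> i. if i = 0 then a else if i = 1 then b else if i = 2 then c else d)
      ` (Eis \<times> Eis \<times> Eis \<times> Eis)" (is "_ \<subseteq> ?f ` _")
  proof
    fix x :: "complex^4" assume "x \<in> Evec"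
    moreover have "x = ?f (x$0, x$1, x$2, x$3)"
      unfolding vec_eq_iff forall_4' by simp
    ultimately show "x \<in> ?f ` (Eis \<times> Eis \<times> Eis \<times> Eis)"
      using image_eqI[of x ?f "(x$0, x$1, x$2, x$3)"] by (simp add: Evec_nth)
  qed
  then show ?thesis
    by (rule countable_subset) (intro countable_image countable_SIGMA countable_Eis)
qed

section \<open>The unitary group and its congruence subgroup\<close>

lemma G3_entries: "g \<in> G3 \<Longrightarrow> g$i$j \<in> Eis"
  and G3_herm: "g \<in> G3 \<Longrightarrow> herm (g *v x) (g *v y) = herm x y"
  by (auto simp: G3_def)

lemma matrix_entry: "(g *v axis j 1) $ i = (g :: complex^4^4)$i$j"
  by (simp add: matrix_vector_mult_def axis_def if_distrib cong: if_cong)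

lemma Evec_matrix_mult: assumes "\<And>i j. g$i$j \<in> Eis" "x \<in> Evec" shows "g *v x \<in> Evec"
proof -
  have "(g *v x)$i \<in> Eis" for i
    unfolding matrix_vector_mult_def vec_lambda_beta by (intro Eis_sum Eis_mult Evec_nth[OF assms(2)] assms(1))
  then show ?thesis by (simp add: Evec_def)
qed

lemma G3_Evec: "g \<in> G3 \<Longrightarrow> x \<in> Evec \<Longrightarrow> g *v x \<in> Evec"
  by (simp add: Evec_matrix_mult G3_entries)

lemma Eis_matrix_mult:
  fixes M N :: "complex^4^4"
  assumes "\<And>i j. M$i$j \<in> Eis" "\<And>i j. N$i$j \<in> Eis" shows "(M ** N)$i$j \<in> Eis"
  unfolding matrix_matrix_mult_def vec_lambda_beta using assms by (intro Eis_sum Eis_mult)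

lemma G3_inverse: assumes "g \<in> G3"
  obtains g' where "g' \<in> G3" "g ** g' = mat 1" "g' ** g = mat 1"
proof -
  obtain N where N: "\<And>i j. N$i$j \<in> Eis" "g ** N = mat 1"
    using assms unfolding G3_def by blast
  have N': "N ** g = mat 1" using N(2) matrix_left_right_inverse by blast
  have "herm (N *v z) (N *v w) = herm z w" for z w
  proof -
    have "herm (N *v z) (N *v w) = herm (g *v (N *v z)) (g *v (N *v w))"
      using G3_herm[OF assms] by simp
    then show ?thesis by (simp add: matrix_vector_mul_assoc N(2))
  qed
  moreover have "\<forall>i j. g$i$j \<in> Eis" using G3_entries[OF assms] by simp
  ultimately have "N \<in> G3" unfolding G3_def using N(1) N' by blast
  then show ?thesis using that N(2) N' by blast
qed

lemma G3_mult: assumes "g \<in> G3" "h \<in> G3" shows "g ** h \<in> G3"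
proof -
  obtain g' h' where i: "g' \<in> G3" "g ** g' = mat 1" "h' \<in> G3" "h ** h' = mat 1"
    using G3_inverse assms by metis
  have "(g ** h) ** (h' ** g') = g ** (h ** h') ** g'" by (simp add: matrix_mul_assoc)
  also have "\<dots> = mat 1" using i by simp
  finally have "(g ** h) ** (h' ** g') = mat 1" .
  moreover have "\<forall>i j. (g ** h)$i$j \<in> Eis" "\<forall>i j. (h' ** g')$i$j \<in> Eis"
    using assms i G3_entries by (simp_all add: Eis_matrix_mult)
  moreover have "\<forall>z w. herm ((g ** h) *v z) ((g ** h) *v w) = herm z w"
    using assms by (simp add: G3_herm flip: matrix_vector_mul_assoc)
  ultimately show ?thesis unfolding G3_def by blast
qed

lemma G3_one: "mat 1 \<in> G3"
proof -
  have "\<forall>i j. (mat 1 :: complex^4^4)$i$j \<in> Eis" by (simp add: mat_def)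
  moreover have "mat 1 ** mat 1 = (mat 1 :: complex^4^4)" by simp
  moreover have "\<forall>z w. herm (mat 1 *v z) (mat 1 *v w) = herm z w" by simp
  ultimately show ?thesis unfolding G3_def by blast
qed

lemma Bt_G3: "g \<in> G3 \<Longrightarrow> g *v z \<in> Bt \<longleftrightarrow> z \<in> Bt"
  by (simp add: Bt_def G3_herm)

lemma G3s3_G3: "g \<in> G3s3 \<Longrightarrow> g \<in> G3"
  by (simp add: G3s3_def)

lemma cong_s3_matrix_vector:
  assumes "\<And>i j. M$i$j \<in> Eis" "\<And>i. cong_s3 (x$i) (y$i)"
  shows "cong_s3 ((M *v x)$i) ((M *v y)$i)"
  unfolding matrix_vector_mult_def vec_lambda_beta using assms by (intro cong_s3_sum cong_s3_mult_left)

lemma G3s3_columns: "g \<in> G3 \<Longrightarrow> (\<And>i j. cong_s3 ((g *v axis j 1)$i) ((axis j 1 :: complex^4)$i)) \<Longrightarrow> g \<in> G3s3"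
  unfolding matrix_entry by (simp add: G3s3_def mat_def axis_def)

lemma G3s3_cong: assumes "g \<in> G3s3" "x \<in> Evec" shows "cong_s3 ((g *v x)$i) (x$i)"
proof -
  have "cong_s3 (\<Sum>j\<in>UNIV. x$j * g$i$j) (\<Sum>j\<in>UNIV. x$j * (mat 1 :: complex^4^4)$i$j)"
    using assms by (intro cong_s3_sum cong_s3_mult_left Evec_nth) (simp_all add: G3s3_def)
  also have "(\<Sum>j\<in>UNIV. x$j * (mat 1 :: complex^4^4)$i$j) = (mat 1 *v x)$i"
    by (simp add: matrix_vector_mult_def mult.commute)
  also have "(\<Sum>j\<in>UNIV. x$j * g$i$j) = (g *v x)$i"
    by (simp add: matrix_vector_mult_def mult.commute)
  finally show ?thesis by simp
qed

text \<open>The kernel of a reduction is normal, and g h is the conjugate of h g by h. This moves a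
  correcting factor from the left of \<open>g\<close> to its right.\<close>

lemma G3s3_conjugate:
  assumes "g \<in> G3" "h \<in> G3" "h ** g \<in> G3s3" shows "g ** h \<in> G3s3"
proof (rule G3s3_columns)
  show "g ** h \<in> G3" using assms G3_mult by blast
  fix i j :: 4
  obtain h' where h': "h' \<in> G3" "h' ** h = mat 1" using G3_inverse assms(2) by metis
  have "(g ** h) *v x = h' *v ((h ** g) *v (h *v x))" for x
  proof -
    have "h' *v ((h ** g) *v (h *v x)) = (h' ** h ** g ** h) *v x"
      by (simp add: matrix_vector_mul_assoc matrix_mul_assoc)
    then show ?thesis using h' by simp
  qed
  then have eq: "(g ** h) *v axis j 1 = h' *v ((h ** g) *v (h *v axis j 1))" .
  have "cong_s3 ((h' *v ((h ** g) *v (h *v axis j 1)))$i) ((h' *v (h *v axis j 1))$i)"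
    using assms h' by (intro cong_s3_matrix_vector G3s3_cong) (simp_all add: G3_entries G3_Evec)
  then show "cong_s3 (((g ** h) *v axis j 1)$i) ((axis j 1 :: complex^4)$i)"
    unfolding eq by (simp only: matrix_vector_mul_assoc[of h' h] h'(2) matrix_vector_mul_lid)
qed

section \<open>Complex reflections\<close>

text \<open>For \<open>b\<close> of nonzero norm this is the reflection with eigenvalue
  \<open>\<xi>\<close> on \<open>b\<close> that fixes the orthogonal complement of \<open>b\<close>.
  The values used are \<open>zeta\<close> (triflection), \<open>- zeta\<close> (order 6) and -1
  (order 2).\<close>

definition crefl :: "complex \<Rightarrow> complex^4 \<Rightarrow> complex^4^4" where
  "crefl \<xi> b = (\<chi> i j. (mat 1 :: complex^4^4)$i$j - (1 - \<xi>) * (heps j * cnj (b$j)) / herm b b * b$i)"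

lemma crefl_mult: "crefl \<xi> b *v x = x - ((1 - \<xi>) * herm b x / herm b b) *s b"
proof -
  have "(crefl \<xi> b *v x)$i = (x - ((1 - \<xi>) * herm b x / herm b b) *s b)$i" for i
  proof -
    have "(crefl \<xi> b *v x)$i = (\<Sum>j\<in>UNIV. (mat 1 :: complex^4^4)$i$j * x$j)
        - (\<Sum>j\<in>UNIV. (1 - \<xi>) / herm b b * b$i * (heps j * cnj (b$j) * x$j))"
      unfolding crefl_def matrix_vector_mult_def
      by (simp add: algebra_simps sum_subtractf)
    also have "(\<Sum>j\<in>UNIV. (mat 1 :: complex^4^4)$i$j * x$j) = (mat 1 *v x)$i"
      by (simp only: matrix_vector_mult_def vec_lambda_beta)
    also have "(\<Sum>j\<in>UNIV. (1 - \<xi>) / herm b b * b$i * (heps j * cnj (b$j) * x$j))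
        = (1 - \<xi>) / herm b b * b$i * herm b x"
      by (simp only: herm_def sum_distrib_left)
    finally show ?thesis by simp
  qed
  then show ?thesis by (simp add: vec_eq_iff)
qed

text \<open>This is the condition that \<open>\<xi>\<close> has modulus one, rewritten for the
  coefficient \<open>\<kappa>\<close>. It is exactly what cancels the extra terms both in the proof
  that the form is preserved and in the product with the conjugate reflection.\<close>

lemma crefl_coefficient:
  assumes "herm b b \<noteq> 0" "cmod \<xi> = 1" and \<kappa>: "\<kappa> = (1 - \<xi>) / herm b b"
  shows "\<kappa> + cnj \<kappa> = \<kappa> * cnj \<kappa> * herm b b"
proof -
  have u: "cnj \<xi> * \<xi> = 1" using assms(2) by (rule unit_cnj_mult)
  have c: "cnj (herm b b) = herm b b" by (simp only: cnj_herm)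
  have k: "\<kappa> * herm b b = 1 - \<xi>" "cnj \<kappa> * herm b b = 1 - cnj \<xi>"
    using assms(1) by (simp_all add: \<kappa> c)
  then have "(\<kappa> + cnj \<kappa>) * herm b b = (\<kappa> * cnj \<kappa> * herm b b) * herm b b"
    using u by algebra
  then show ?thesis using assms(1) by simp
qed

lemma crefl_herm:
  assumes "herm b b \<noteq> 0" "cmod \<xi> = 1"
  shows "herm (crefl \<xi> b *v x) (crefl \<xi> b *v y) = herm x y"
proof -
  define \<kappa> where "\<kappa> = (1 - \<xi>) / herm b b"
  have r: "crefl \<xi> b *v z = z - (\<kappa> * herm b z) *s b" for z
    by (simp add: crefl_mult \<kappa>_def)
  have "herm (crefl \<xi> b *v x) (crefl \<xi> b *v y) = herm x y
      - (\<kappa> + cnj \<kappa>) * herm x b * herm b y + (\<kappa> * cnj \<kappa> * herm b b) * herm x b * herm b y"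
    unfolding r herm_linear complex_cnj_mult cnj_herm by (simp add: algebra_simps)
  then show ?thesis using crefl_coefficient[OF assms \<kappa>_def] by simp
qed

text \<open>The inverse is the reflection with eigenvalue \<open>cnj \<xi>\<close>, whose
  coefficient is the conjugate one and hence integral too. Besides vectors of norm -1 this admits
  vectors of norm -2 when \<open>\<xi>\<close> is -1.\<close>

lemma crefl_G3:
  assumes b: "b \<in> Evec" "herm b b \<noteq> 0" and xi: "cmod \<xi> = 1" "(1 - \<xi>) / herm b b \<in> Eis"
  shows "crefl \<xi> b \<in> G3"
proof -
  have c: "cnj (herm b b) = herm b b" by (simp only: cnj_herm)
  have "cnj ((1 - \<xi>) / herm b b) \<in> Eis" using xi(2) by blast
  then have xi': "(1 - cnj \<xi>) / herm b b \<in> Eis" by (simp add: c)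
  have ent: "crefl \<eta> b $ i $ j \<in> Eis" if "(1 - \<eta>) / herm b b \<in> Eis" for \<eta> i j
  proof -
    have "crefl \<eta> b $ i $ j = (mat 1 :: complex^4^4)$i$j - (1 - \<eta>) / herm b b * (heps j * cnj (b$j) * b$i)"
      by (simp add: crefl_def)
    moreover have "(mat 1 :: complex^4^4)$i$j \<in> Eis" by (simp add: mat_def)
    ultimately show ?thesis using that b(1) by (simp only: Eis_diff Eis_mult Eis_heps Eis_cnj Evec_nth)
  qed
  define \<kappa> where "\<kappa> = (1 - \<xi>) / herm b b"
  have r: "crefl \<xi> b *v z = z - (\<kappa> * herm b z) *s b"
    "crefl (cnj \<xi>) b *v z = z - (cnj \<kappa> * herm b z) *s b" for z
    by (simp_all add: crefl_mult \<kappa>_def c)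
  have "(crefl \<xi> b ** crefl (cnj \<xi>) b) *v x = mat 1 *v x" for x
  proof -
    have "(crefl \<xi> b ** crefl (cnj \<xi>) b) *v x = crefl \<xi> b *v (crefl (cnj \<xi>) b *v x)"
      by (simp add: matrix_vector_mul_assoc)
    also have "\<dots> = x - (((\<kappa> + cnj \<kappa>) - \<kappa> * cnj \<kappa> * herm b b) * herm b x) *s b"
      unfolding r herm_linear vec_eq_iff by (simp add: algebra_simps)
    finally show ?thesis using crefl_coefficient[OF b(2) xi(1) \<kappa>_def] by simp
  qed
  then have "crefl \<xi> b ** crefl (cnj \<xi>) b = mat 1" using matrix_eq by blast
  then show ?thesis
    unfolding G3_def using ent[OF xi(2)] ent[OF xi'] crefl_herm[OF b(2) xi(1)] by blast
qed

lemma triflection_crefl: "triflection b = crefl zeta b"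
  by (simp add: triflection_def crefl_def)

lemma cmod_zeta: "cmod zeta = 1"
  by (simp add: zeta_def cmod_def power_divide)

lemma triflection_G3s3: assumes "a \<in> Evec" "herm a a = -1" shows "triflection a \<in> G3s3"
proof -
  have "triflection a \<in> G3"
    unfolding triflection_crefl using assms by (intro crefl_G3) (auto simp: cmod_zeta)
  moreover have "cong_s3 (triflection a $ i $ j) ((mat 1 :: complex^4^4)$i$j)" for i j
  proof -
    have "triflection a $ i $ j - (mat 1 :: complex^4^4)$i$j = (1 - zeta) * (heps j * cnj (a$j) * a$i)"
      by (simp add: triflection_def assms)
    also have "\<dots> = s3 * ((-1 - zeta) * (heps j * cnj (a$j) * a$i))"
      unfolding one_minus_zeta by (simp add: algebra_simps)
    finally show ?thesis unfolding cong_s3_def using assms by (auto simp: Evec_nth)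
  qed
  ultimately show ?thesis by (simp add: G3s3_def)
qed

lemma triflection_mult: "herm a a = -1 \<Longrightarrow> triflection a *v x = x + ((1 - zeta) * herm a x) *s a"
  by (simp add: triflection_crefl crefl_mult vec_eq_iff)

section \<open>Transitivity on vectors of norm -1\<close>

definition G3_equiv :: "complex^4 \<Rightarrow> complex^4 \<Rightarrow> bool" where
  "G3_equiv x y \<longleftrightarrow> (\<exists>g\<in>G3. x = g *v y)"

lemma G3_equiv_sym: assumes "G3_equiv x y" shows "G3_equiv y x"
proof -
  obtain g where g: "g \<in> G3" "x = g *v y" using assms by (auto simp: G3_equiv_def)
  obtain g' where g': "g' \<in> G3" "g' ** g = mat 1" using G3_inverse[OF g(1)] by metis
  then have "y = g' *v x" unfolding g(2) by (simp add: matrix_vector_mul_assoc)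
  then show ?thesis using g' by (auto simp: G3_equiv_def)
qed

lemma G3_equiv_trans: "G3_equiv x y \<Longrightarrow> G3_equiv y z \<Longrightarrow> G3_equiv x z"
  unfolding G3_equiv_def by (metis G3_mult matrix_vector_mul_assoc)

lemma mat_scalar_mult: "mat c *v x = c *s (x :: complex^4)"
  by (simp add: vec_eq_iff mat_def matrix_vector_mult_def if_distrib if_distribR cong: if_cong)

lemma scalar_G3: assumes "u \<in> Eis" "cmod u = 1" shows "mat u \<in> G3"
proof -
  have u: "cnj u * u = 1" using assms(2) by (rule unit_cnj_mult)
  have "(mat u ** mat (cnj u)) *v x = mat 1 *v x" for x :: "complex^4"
    using u by (simp add: mat_scalar_mult mult.commute flip: matrix_vector_mul_assoc)
  then have "mat u ** mat (cnj u) = (mat 1 :: complex^4^4)" using matrix_eq by blast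
  moreover have "\<forall>i j. (mat u :: complex^4^4)$i$j \<in> Eis" "\<forall>i j. (mat (cnj u) :: complex^4^4)$i$j \<in> Eis"
    using assms by (auto simp: mat_def)
  moreover have "\<forall>z w. herm (mat u *v z) (mat u *v w) = herm z w"
    using u by (simp add: mat_scalar_mult herm_linear mult.commute flip: mult.assoc)
  ultimately show ?thesis unfolding G3_def by blast
qed

text \<open>The number \<open>1 + zeta\<close> is a primitive sixth root of unity; it is the
  coefficient of the order 6 reflection along a vector of norm -1.\<close>

lemma cnj_one_plus_zeta: "cnj (1 + zeta) = - zeta" "(1 + zeta) * - zeta = 1"
  using zeta_squared by (simp add: cnj_zeta, algebra)

lemma cmod_one_plus_zeta: "cmod (1 + zeta) = 1"
  by (metis cnj_one_plus_zeta(1) cmod_zeta complex_mod_cnj norm_minus_cancel)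

lemma hexaflection_G3: assumes "b \<in> Evec" "herm b b = -1" shows "crefl (- zeta) b \<in> G3"
  using assms by (intro crefl_G3) (auto simp: cmod_zeta)

lemma hexaflection_mult:
  "herm b b = -1 \<Longrightarrow> crefl (- zeta) b *v x = x + ((1 + zeta) * herm b x) *s b"
  by (simp add: crefl_mult vec_eq_iff)

lemma G3_equiv_unit_herm:
  assumes a: "a \<in> Evec" "herm a a = -1" and c: "c \<in> Evec" "herm c c = -1"
    and ac: "cmod (herm a c) = 1"
  shows "G3_equiv a c"
proof -
  \<comment> \<open>This unit makes \<open>a - u c\<close> a vector of norm -1; the reflection along it maps \<open>u c\<close> to \<open>a\<close>.\<close>
  define u where "u = - ((1 + zeta) * cnj (herm a c))"
  have u: "u \<in> Eis" "cmod u = 1"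
    using a c ac by (auto simp: u_def norm_mult cmod_one_plus_zeta)
  have uu: "cnj u * u = 1" using u(2) by (rule unit_cnj_mult)
  have "cnj (herm a c) * herm a c = 1" using ac by (rule unit_cnj_mult)
  then have e: "u * herm a c = - (1 + zeta)" by (simp add: u_def mult.assoc)
  then have e': "cnj u * herm c a = zeta"
    by (metis cnj_herm complex_cnj_minus complex_cnj_mult cnj_one_plus_zeta(1) minus_minus)
  define b where "b = a - u *s c"
  have b: "b \<in> Evec" unfolding b_def using a c u by blast
  \<comment> \<open>The two cross terms are \<open>- (1 + zeta)\<close> and \<open>zeta\<close>,
    with sum -1, so the norm is -1 - 1 + 1.\<close>
  have b1: "herm b b = -1"
    unfolding b_def herm_linear a c using e e' uu by algebra
  have b2: "herm b (u *s c) = - zeta"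
    unfolding b_def herm_linear c using e uu by algebra
  have "crefl (- zeta) b *v (u *s c) = u *s c + b"
    unfolding hexaflection_mult[OF b1] b2 by (simp only: cnj_one_plus_zeta(2)) simp
  then have "a = crefl (- zeta) b *v (mat u *v c)" by (simp add: mat_scalar_mult b_def)
  then have "a = (crefl (- zeta) b ** mat u) *v c" by (simp add: matrix_vector_mul_assoc)
  moreover have "crefl (- zeta) b ** mat u \<in> G3"
    using hexaflection_G3[OF b b1] scalar_G3[OF u] by (rule G3_mult)
  ultimately show ?thesis unfolding G3_equiv_def by blast
qed

definition vec4 :: "complex \<Rightarrow> complex \<Rightarrow> complex \<Rightarrow> complex \<Rightarrow> complex^4" where
  "vec4 p q r s = (\<chi> i. if i = 0 then p else if i = 1 then q else if i = 2 then r else s)"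

lemma vec4_nth [simp]:
  "vec4 p q r s $ 0 = p" "vec4 p q r s $ 1 = q" "vec4 p q r s $ 2 = r" "vec4 p q r s $ 3 = s"
  by (simp_all add: vec4_def)

lemma vec4_Evec [simp, intro]:
  "p \<in> Eis \<Longrightarrow> q \<in> Eis \<Longrightarrow> r \<in> Eis \<Longrightarrow> s \<in> Eis \<Longrightarrow> vec4 p q r s \<in> Evec"
  by (auto simp: Evec_def vec4_def)

lemma G3_equiv_unit_coordinate:
  assumes "a \<in> Evec" "herm a a = -1" "k \<noteq> 0" "cmod (a$k) = 1"
  shows "G3_equiv a (axis k 1)"
  using assms by (intro G3_equiv_unit_herm) (auto simp: herm_axis_left herm_axis_right heps_def)

text \<open>The two basis vectors are orthogonal, so the criterion with a unit product does not link
  them directly. The vector (1, 0, 1, 1) of norm -1 has a unit product with each of them.\<close>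

lemma G3_equiv_axis: "G3_equiv (axis 3 1) (axis 2 1)"
proof -
  have w: "vec4 1 0 1 1 \<in> Evec" "herm (vec4 1 0 1 1) (vec4 1 0 1 1) = -1"
    by (auto simp: herm_expand)
  have "G3_equiv (vec4 1 0 1 1) (axis 3 1)" "G3_equiv (vec4 1 0 1 1) (axis 2 1)"
    by (rule G3_equiv_unit_coordinate[OF w]; simp)+
  then show ?thesis using G3_equiv_sym G3_equiv_trans by blast
qed

text \<open>
With \<open>\<rho> = (1, 1, 0, 0)\<close>, the quantity to be decreased is \<open>h(\<rho>, a) = a\<^sub>0 - a\<^sub>1\<close>. Scaling \<open>a\<close> so that
\<open>h(\<rho>, \<alpha>) = 1\<close>, the reflection along \<open>b\<close> with \<open>h(\<rho>, b) = 1\<close> multiplies it by \<open>1 + (1 + \<zeta>) w\<close>, where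
\<open>w = h(b, \<alpha>)\<close>. The real part of \<open>w\<close> is governed by the distance of \<open>(b\<^sub>2, b\<^sub>3)\<close> from \<open>(\<alpha>\<^sub>2, \<alpha>\<^sub>3)\<close>, its
imaginary part can be shifted by multiples of \<open>\<surd>3\<close> on adding multiples of \<open>\<surd>-3 \<rho>\<close> to \<open>b\<close>.
\<close>

lemma hexaflection_descent:
  assumes a: "a \<in> Evec" "herm a a = -1" and m: "cmod (a$0 - a$1) > 1"
  obtains b where "b \<in> Evec" "herm b b = -1"
    "cmod ((crefl (- zeta) b *v a)$0 - (crefl (- zeta) b *v a)$1) < cmod (a$0 - a$1)"
proof -
  define m where "m = a$0 - a$1"
  have m0: "m \<noteq> 0" using m unfolding m_def by auto
  define \<alpha> where "\<alpha> = (1 / m) *s a"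
  have am: "a = m *s \<alpha>" using m0 by (simp add: \<alpha>_def vec_eq_iff)
  have \<alpha>01: "\<alpha>$1 = \<alpha>$0 - 1"
    using m0 unfolding \<alpha>_def by (simp add: field_simps) (simp add: m_def)
  define M where "M = (cmod m)\<^sup>2"
  have M1: "M > 1" using m unfolding M_def m_def by (simp add: one_less_power)
  have "herm \<alpha> \<alpha> = cnj (1 / m) * (1 / m) * herm a a" unfolding \<alpha>_def herm_linear by simp
  also have "\<dots> = - of_real (1 / M)"
    unfolding a M_def complex_norm_square by (simp add: complex_norm_square mult.commute del: of_real_power)
  finally have n\<alpha>: "(cmod (\<alpha>$0))\<^sup>2 - (cmod (\<alpha>$0 - 1))\<^sup>2 - (cmod (\<alpha>$2))\<^sup>2 - (cmod (\<alpha>$3))\<^sup>2 = - (1 / M)"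
    unfolding herm_self \<alpha>01 by (metis of_real_eq_iff of_real_minus)
  obtain b2 where b2: "b2 \<in> Eis" "(cmod (\<alpha>$2 - b2))\<^sup>2 \<le> 7/16" using Eis_approx by blast
  obtain b3 where b3: "b3 \<in> Eis" "(cmod (\<alpha>$3 - b3))\<^sup>2 \<le> 7/16" using Eis_approx by blast
  obtain n2 n3 :: nat where n: "(cmod b2)\<^sup>2 = real n2" "(cmod b3)\<^sup>2 = real n3"
    using Eis_norm b2(1) b3(1) by metis
  define n where "n = int n2 + int n3"
  \<comment> \<open>This is the imaginary part that \<open>w\<close> has for \<open>k = 0\<close>.
    Each unit of \<open>k\<close> lowers it by \<open>sqrt 3\<close>, so the floor brings it between
    0 and \<open>sqrt 3\<close>.\<close>
  define y where "y = Im (\<alpha>$0 - cnj b2 * \<alpha>$2 - cnj b3 * \<alpha>$3) - n * (sqrt 3 / 2)"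
  define k where "k = \<lfloor>y / sqrt 3\<rfloor>"
  \<comment> \<open>Norm -1 for \<open>(b1 + 1, b1, b2, b3)\<close> means
    \<open>2 * Re b1 + 1 = n - 1\<close>. The first two terms achieve this, and a multiple of
    \<open>s3\<close> is purely imaginary and so leaves it intact.\<close>
  define b1 where "b1 = of_int (n - 1) + of_int n * zeta + of_int k * s3"
  have b1: "b1 \<in> Eis" unfolding b1_def by blast
  have re_b1: "Re b1 = n / 2 - 1" and im_b1: "Im b1 = n * (sqrt 3 / 2) + k * sqrt 3"
    unfolding b1_def by (simp_all add: zeta_def s3_def)
  define b where "b = vec4 (b1 + 1) b1 b2 b3"
  have b: "b \<in> Evec" unfolding b_def using b1 b2 b3 by blast
  have "(cmod (b1 + 1))\<^sup>2 - (cmod b1)\<^sup>2 = 2 * Re b1 + 1"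
    unfolding cmod_power2 by (simp add: power2_eq_square algebra_simps)
  then have "(cmod (b1 + 1))\<^sup>2 - (cmod b1)\<^sup>2 - (cmod b2)\<^sup>2 - (cmod b3)\<^sup>2 = -1"
    unfolding n re_b1 n_def by (simp add: add_divide_distrib)
  then have bb: "herm b b = -1"
    unfolding herm_self b_def vec4_nth by simp
  define w where "w = herm b \<alpha>"
  have w_eq: "w = cnj b1 + (\<alpha>$0 - cnj b2 * \<alpha>$2 - cnj b3 * \<alpha>$3)"
    unfolding w_def herm_expand by (simp add: b_def \<alpha>01 algebra_simps)
  define D where "D = (cmod (\<alpha>$2 - b2))\<^sup>2 + (cmod (\<alpha>$3 - b3))\<^sup>2"
  have D: "0 \<le> D" "D < 1" using b2 b3 by (auto simp: D_def)
  have "D = (cmod (\<alpha>$2))\<^sup>2 + (cmod (\<alpha>$3))\<^sup>2 + n - 2 * Re (cnj b2 * \<alpha>$2) - 2 * Re (cnj b3 * \<alpha>$3)"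
    using n unfolding D_def n_def cmod_power2 by (simp add: power2_eq_square algebra_simps)
  moreover have "2 * Re (\<alpha>$0) - 1 = (cmod (\<alpha>$0))\<^sup>2 - (cmod (\<alpha>$0 - 1))\<^sup>2"
    unfolding cmod_power2 by (simp add: power2_eq_square algebra_simps)
  \<comment> \<open>Completing the square against the norm of \<open>\<alpha>\<close> turns the real
    part into the approximation error \<open>D\<close>, apart from the small term
    \<open>1 / M\<close>.\<close>
  ultimately have re_w: "Re w + 1/2 = (D - 1 / M) / 2"
    using n\<alpha> unfolding w_eq by (simp add: re_b1 field_simps)
  have "1 / M > 0" "1 / M < 1" using M1 by auto
  then have "-1 < D - 1 / M" "D - 1 / M < 1" using D by linarith+
  then have "\<bar>Re w + 1/2\<bar> < 1/2" unfolding re_w by (simp add: abs_less_iff)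
  then have sq1: "(Re w + 1/2)\<^sup>2 < (1/2)\<^sup>2" by (metis abs_ge_zero power2_abs power_strict_mono zero_less_numeral)
  have im_w: "Im w = y - k * sqrt 3"
    unfolding w_eq y_def by (simp add: im_b1)
  have "of_int k \<le> y / sqrt 3" "y / sqrt 3 < of_int k + 1" unfolding k_def by linarith+
  then have "0 \<le> Im w" "Im w \<le> sqrt 3"
    unfolding im_w by (simp_all add: field_simps)
  then have "\<bar>Im w - sqrt 3 / 2\<bar> \<le> sqrt 3 / 2" unfolding abs_le_iff by linarith
  then have "(Im w - sqrt 3 / 2)\<^sup>2 \<le> (sqrt 3 / 2)\<^sup>2" by (metis abs_ge_zero power2_abs power_mono)
  \<comment> \<open>The bounds place \<open>w\<close> in a rectangle centred at \<open>zeta\<close>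
    with half-sides 1/2 and \<open>sqrt 3 / 2\<close>. Its corners lie on the unit circle about
    \<open>zeta\<close>, and strictness in the real direction excludes them.\<close>
  then have "(cmod (w - zeta))\<^sup>2 < 1"
    using sq1 unfolding cmod_power2 by (simp add: zeta_def power_divide)
  then have w1: "cmod (w - zeta) < 1" by (simp add: abs_square_less_1)
  have "(crefl (- zeta) b *v a)$0 - (crefl (- zeta) b *v a)$1 = m + (1 + zeta) * (m * w)"
    unfolding hexaflection_mult[OF bb] am herm_linear w_def
    by (simp add: b_def \<alpha>01 algebra_simps)
  also have "\<dots> = m * ((1 + zeta) * (w - zeta))"
    using cnj_one_plus_zeta(2) by algebra
  finally have "cmod ((crefl (- zeta) b *v a)$0 - (crefl (- zeta) b *v a)$1) = cmod m * cmod (w - zeta)"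
    by (simp add: norm_mult cmod_one_plus_zeta)
  also have "\<dots> < cmod m" using w1 m0 by simp
  finally show ?thesis using that b bb unfolding m_def by blast
qed

text \<open>Strong induction on the squared modulus \<open>n\<close> of \<open>a$0 - a$1\<close>.
  For \<open>n = 0\<close> one of the last two coordinates is a unit, for \<open>n = 1\<close> an
  auxiliary vector with unit products connects \<open>a\<close> to the basis vector, and for larger
  \<open>n\<close> the descent applies.\<close>

lemma G3_equiv_axis_2:
  assumes "a \<in> Evec" "herm a a = -1"
  shows "G3_equiv a (axis 2 1)"
proof -
  obtain n :: nat where "(cmod (a$0 - a$1))\<^sup>2 = real n"
    using Eis_norm assms(1) by (metis Eis_diff Evec_nth)
  then show ?thesis using assms
  proof (induction n arbitrary: a rule: less_induct)
    case (less n)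
    note a = less.prems(2,3)
    define m where "m = a$0 - a$1"
    have m: "m \<in> Eis" using a unfolding m_def by auto
    consider "n = 0" | "n = 1" | "n > 1" by linarith
    then show ?case
    proof cases
      case 1
      then have "a$0 = a$1" using less.prems(1) by simp
      then have s: "(cmod (a$2))\<^sup>2 + (cmod (a$3))\<^sup>2 = 1"
        using a(2) unfolding herm_self by (simp flip: of_real_power of_real_add) (simp add: complex_eq_iff)
      obtain p q :: nat where pq: "(cmod (a$2))\<^sup>2 = real p" "(cmod (a$3))\<^sup>2 = real q"
        using Eis_norm a(1) by (metis Evec_nth)
      have "p + q = 1" using s unfolding pq by linarith
      then have "p = 1 \<or> q = 1" by linarith
      moreover have "cmod x = 1" if "(cmod x)\<^sup>2 = real 1" for x
        using that by (metis abs_norm_cancel abs_square_eq_1 of_nat_1)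
      ultimately have "cmod (a$2) = 1 \<or> cmod (a$3) = 1" using pq by blast
      then show ?thesis
        using G3_equiv_unit_coordinate[OF a, of 2] G3_equiv_unit_coordinate[OF a, of 3]
          G3_equiv_axis G3_equiv_trans by auto
    next
      case 2
      have mm: "cnj m * m = 1"
        using less.prems(1) 2 complex_norm_square[of m] by (simp add: m_def mult.commute)
      \<comment> \<open>Any vector (t, t, 1, 0) has norm -1; this \<open>t\<close> makes its product
        with \<open>a\<close> equal to \<open>(1 + a$2) - a$2 = 1\<close>.\<close>
      define t where "t = (1 + cnj (a$2)) * m"
      define b where "b = vec4 t t 1 0"
      have b: "b \<in> Evec" "herm b b = -1"
        using a(1) m by (auto simp: b_def t_def herm_expand Evec_nth)
      have "herm b a = cnj t * m - a$2" by (simp add: herm_expand b_def m_def algebra_simps)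
      also have "\<dots> = 1" using mm by (simp add: t_def mult.assoc)
      finally have "cmod (herm b a) = 1" by simp
      then have "G3_equiv b a" using a b by (intro G3_equiv_unit_herm)
      moreover have "G3_equiv b (axis 2 1)"
        using b by (intro G3_equiv_unit_coordinate) (auto simp: b_def)
      ultimately show ?thesis using G3_equiv_sym G3_equiv_trans by blast
    next
      case 3
      then have "(cmod (a$0 - a$1))\<^sup>2 > 1" using less.prems(1) by simp
      then have "cmod (a$0 - a$1) > 1" by (metis abs_norm_cancel abs_square_le_1 not_less)
      then obtain b where b: "b \<in> Evec" "herm b b = -1"
        "cmod ((crefl (- zeta) b *v a)$0 - (crefl (- zeta) b *v a)$1) < cmod (a$0 - a$1)"
        using hexaflection_descent[OF a] by blast
      define a' where "a' = crefl (- zeta) b *v a"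
      have g: "crefl (- zeta) b \<in> G3" using hexaflection_G3 b by blast
      have a': "a' \<in> Evec" "herm a' a' = -1" unfolding a'_def using g a by (auto simp: G3_Evec G3_herm)
      obtain n' :: nat where n': "(cmod (a'$0 - a'$1))\<^sup>2 = real n'"
        using Eis_norm a'(1) by (metis Eis_diff Evec_nth)
      have "real n' < real n"
        unfolding n'[symmetric] less.prems(1)[symmetric] a'_def using b(3) by (simp add: power_strict_mono)
      then have "G3_equiv a' (axis 2 1)" using less.IH n' a' by simp
      moreover have "G3_equiv a' a" unfolding G3_equiv_def a'_def using g by blast
      ultimately show ?thesis using G3_equiv_sym G3_equiv_trans by blast
    qed
  qed
qed

section \<open>Orbits of the congruence subgroup\<close>

definition cong_vec :: "complex^4 \<Rightarrow> complex^4 \<Rightarrow> bool" where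
  "cong_vec x y \<longleftrightarrow> (\<forall>i. cong_s3 (x$i) (y$i))"

lemma cong_vec_refl [simp, intro]: "cong_vec x x"
  by (simp add: cong_vec_def)

lemma cong_vec_trans [trans]: "cong_vec x y \<Longrightarrow> cong_vec y z \<Longrightarrow> cong_vec x z"
  unfolding cong_vec_def using cong_s3_trans by blast

lemma cong_vec_G3: "g \<in> G3 \<Longrightarrow> cong_vec x y \<Longrightarrow> cong_vec (g *v x) (g *v y)"
  unfolding cong_vec_def by (simp add: cong_s3_matrix_vector G3_entries)

lemma cong_vec_scale: "c \<in> Eis \<Longrightarrow> cong_vec x y \<Longrightarrow> cong_vec (c *s x) (c *s y)"
  unfolding cong_vec_def by auto

lemma cong_s3_herm:
  assumes "cong_vec x x'" "cong_vec y y'" "x \<in> Evec" "y' \<in> Evec"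
  shows "cong_s3 (herm x y) (herm x' y')"
  unfolding herm_def mult.assoc using assms
  by (intro cong_s3_sum cong_s3_mult_left cong_s3_mult cong_s3_cnj Eis_heps Eis_cnj Evec_nth)
    (simp_all add: cong_vec_def)

text \<open>Columns \<open>l\<close> and \<open>j\<close> are orthogonal, and modulo
  \<open>s3\<close> the product with column \<open>l\<close> reads off the entry of index
  \<open>l\<close> up to sign.\<close>

lemma cong_vec_orthogonal:
  assumes g: "g \<in> G3" and l: "cong_vec (g *v axis l 1) (axis l 1)" and "j \<noteq> l"
  shows "cong_s3 ((g *v axis j 1)$l) 0"
proof -
  have "cong_s3 (herm (g *v axis l 1) (g *v axis j 1)) (herm (axis l 1) (g *v axis j 1))"
    using g l by (intro cong_s3_herm) (auto simp: G3_Evec)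
  then have "cong_s3 0 (heps l * (g *v axis j 1)$l)"
    using \<open>j \<noteq> l\<close> by (simp add: G3_herm[OF g] herm_axis_left) (simp add: axis_def)
  then have "cong_s3 (heps l * (heps l * (g *v axis j 1)$l)) (heps l * 0)"
    using cong_s3_sym Eis_heps by blast
  then show ?thesis by (simp flip: mult.assoc)
qed

section \<open>Lifting from the field with three elements\<close>

definition int_vec :: "(4 \<Rightarrow> int) \<Rightarrow> complex^4" where
  "int_vec r = (\<chi> i. of_int (r i))"

lemma int_vec_Evec [simp, intro]: "int_vec r \<in> Evec"
  by (simp add: int_vec_def Evec_def)

lemma herm_int_vec: "herm (int_vec r) (int_vec r) = of_int ((r 0)\<^sup>2 - (r 1)\<^sup>2 - (r 2)\<^sup>2 - (r 3)\<^sup>2)"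
  unfolding herm_expand int_vec_def by (simp add: power2_eq_square)

text \<open>Replacing a column by its vector of residues in -1, 0, 1 reduces the question to
  finitely many cases, while retaining orthogonality to the finished columns and the norm modulo
  \<open>s3\<close>.\<close>

lemma column_residue:
  assumes g: "g \<in> G3" and S: "\<And>l. l \<in> S \<Longrightarrow> cong_vec (g *v axis l 1) (axis l 1)" and "j \<notin> S"
  obtains r where "cong_vec (g *v axis j 1) (int_vec r)" "\<And>l. r l \<in> {-1, 0, 1}"
    "\<And>l. l \<in> S \<Longrightarrow> r l = 0" "cong_s3 (herm (int_vec r) (int_vec r)) (heps j)"
proof -
  have x: "g *v axis j 1 \<in> Evec" using g by (auto simp: G3_Evec)
  have "\<forall>l. \<exists>r :: int. r \<in> {-1, 0, 1} \<and> cong_s3 ((g *v axis j 1)$l) (of_int r)"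
    using Eis_residue Evec_nth[OF x] by metis
  then obtain r where r: "\<And>l. r l \<in> {-1, 0, 1 :: int}" "\<And>l. cong_s3 ((g *v axis j 1)$l) (of_int (r l))"
    by metis
  have c: "cong_vec (g *v axis j 1) (int_vec r)" using r(2) by (simp add: cong_vec_def int_vec_def)
  have "r l = 0" if "l \<in> S" for l
  proof -
    have "cong_s3 ((g *v axis j 1)$l) 0"
      using cong_vec_orthogonal[OF g S[OF that]] that \<open>j \<notin> S\<close> by metis
    then have "cong_s3 (of_int (r l)) 0" using r(2)[of l] cong_s3_sym cong_s3_trans by blast
    then have "3 dvd r l" by (rule cong_s3_of_int_0)
    then show ?thesis using r(1)[of l] by auto
  qed
  moreover have "cong_s3 (herm (g *v axis j 1) (g *v axis j 1)) (herm (int_vec r) (int_vec r))"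
    using c x by (intro cong_s3_herm) auto
  then have "cong_s3 (herm (int_vec r) (int_vec r)) (heps j)"
    using cong_s3_sym by (simp add: G3_herm[OF g] herm_axis_left)
  ultimately show ?thesis using that c r(1) by blast
qed

lemma reflection_fixes: "b$l = 0 \<Longrightarrow> crefl \<xi> b *v axis l 1 = axis l 1"
  by (simp add: crefl_mult herm_axis_right)

lemma reflection_sign:
  obtains h where "h \<in> G3" "\<And>l. l \<noteq> j \<Longrightarrow> h *v axis l 1 = axis l 1" "h *v axis j (-1) = axis j 1"
proof
  show "crefl (-1) (axis j 1) \<in> G3"
    by (intro crefl_G3) (auto simp: herm_axis_left heps_def)
  show "crefl (-1) (axis j 1) *v axis l 1 = axis l 1" if "l \<noteq> j" for l
    using that by (intro reflection_fixes) (simp add: axis_def)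
  show "crefl (-1) (axis j 1) *v axis j (-1) = axis j 1"
    unfolding crefl_mult herm_axis_left by (simp add: vec_eq_iff axis_def heps_def)
qed

text \<open>The order 2 reflection along the difference of two vectors of equal norm with real
  product exchanges them; this settles nonzero \<open>j\<close>. For \<open>j = 0\<close> the norms
  1 and -2 agree only modulo 3, and the same reflection achieves the goal up to congruence. In both
  cases \<open>b\<close> has norm -1 or -2, so the reflection is integral.\<close>

lemma reflection_move:
  assumes "r j = 0" "\<And>l. l \<in> S \<Longrightarrow> r l = 0" "j \<notin> S"
    and N: "herm (int_vec r) (int_vec r) = (if j = 0 then -2 else -1)"
  obtains h where "h \<in> G3" "\<And>l. l \<in> S \<Longrightarrow> h *v axis l 1 = axis l 1"
    "cong_vec (h *v int_vec r) (axis j 1)"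
proof
  define b where "b = axis j 1 - int_vec r"
  have o: "herm (axis j 1) (int_vec r) = 0" "herm (int_vec r) (axis j 1) = 0"
    using assms(1) by (simp_all add: herm_axis_left herm_axis_right int_vec_def)
  have bb: "herm b b = (if j = 0 then -1 else -2)"
    unfolding b_def herm_linear o N by (simp add: herm_axis_left heps_def)
  have br: "herm b (int_vec r) = (if j = 0 then 2 else 1)"
    unfolding b_def herm_linear o N by simp
  show "crefl (-1) b \<in> G3"
  proof (rule crefl_G3)
    show "b \<in> Evec" unfolding b_def by blast
  qed (simp_all add: bb)
  show "crefl (-1) b *v axis l 1 = axis l 1" if "l \<in> S" for l
    using that assms by (intro reflection_fixes) (auto simp: b_def int_vec_def axis_def)
  \<comment> \<open>For \<open>j = 0\<close> the image equals four times the basis vector minus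
    three times the residue vector, and 3 is divisible by \<open>s3\<close>.\<close>
  have "crefl (-1) b *v int_vec r = (if j = 0 then int_vec r + 4 *s b else axis j 1)"
    unfolding crefl_mult bb br by (simp add: b_def vec_eq_iff)
  moreover have "cong_s3 ((int_vec r + 4 *s b)$i) ((axis j 1 :: complex^4)$i)" for i
  proof -
    have "cong_s3 (of_int (4 * (if i = j then 1 else 0) - 3 * r i)) (of_int (if i = j then 1 else 0))"
      by (rule cong_s3_of_int, rule dvdI[of _ _ "(if i = j then 1 else 0) - r i"]) simp
    then show ?thesis by (cases "i = j") (simp_all add: b_def int_vec_def axis_def algebra_simps)
  qed
  ultimately show "cong_vec (crefl (-1) b *v int_vec r) (axis j 1)"
    by (cases "j = 0") (simp_all add: cong_vec_def)
qed

lemma int_vec_axis: "(\<And>l. l \<noteq> j \<Longrightarrow> r l = 0) \<Longrightarrow> int_vec r = axis j (of_int (r j))"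
  by (auto simp: vec_eq_iff int_vec_def axis_def)

text \<open>The squares of the entries are 0 or 1. Since the entry at \<open>k\<close> vanishes, and
  for nonzero \<open>j\<close> also the entry at 0, so few nonzero entries remain that the norm
  modulo 3 leaves only a signed basis vector or a vector with zero entry at \<open>j\<close> and
  known integral norm.\<close>

lemma residue_cases:
  assumes r: "\<And>l. r l \<in> {-1, 0, 1 :: int}" and n: "cong_s3 (herm (int_vec r) (int_vec r)) (heps j)"
    and k: "k \<noteq> 0" "k \<noteq> j" "r k = 0" and j: "j = 0 \<or> r 0 = 0"
  shows "(\<forall>l. l \<noteq> j \<longrightarrow> r l = 0) \<and> (r j = 1 \<or> r j = -1) \<or>
    r j = 0 \<and> herm (int_vec r) (int_vec r) = (if j = 0 then -2 else -1)"
proof -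
  define q where "q l = (r l)\<^sup>2" for l
  have q: "q l = 0 \<or> q l = 1" and q0: "q l = 0 \<longleftrightarrow> r l = 0" for l
    using r[of l] by (auto simp: q_def)
  define e :: int where "e = (if j = 0 then 1 else -1)"
  have "cong_s3 (of_int (q 0 - q 1 - q 2 - q 3)) (of_int e)"
    using n unfolding herm_int_vec q_def by (cases "j = 0") (simp_all add: e_def heps_def)
  then have "cong_s3 (of_int (q 0 - q 1 - q 2 - q 3) + of_int (- e)) (of_int e + of_int (- e))"
    by (intro cong_s3_add) auto
  then have "cong_s3 (of_int (q 0 - q 1 - q 2 - q 3 - e)) 0" by simp
  then have d: "3 dvd q 0 - q 1 - q 2 - q 3 - e" by (rule cong_s3_of_int_0)
  have H: "herm (int_vec r) (int_vec r) = of_int (q 0 - q 1 - q 2 - q 3)"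
    unfolding herm_int_vec q_def by simp
  have rj: "r j = 1 \<or> r j = -1" if "q j = 1" using r[of j] q0[of j] that by auto
  have qk: "q k = 0" using k q0 by simp
  have cases4: "P 0 \<Longrightarrow> P 1 \<Longrightarrow> P 2 \<Longrightarrow> P 3 \<Longrightarrow> P x" for P and x :: 4
    using forall_4'[of P] by blast
  have main: "(\<forall>l. l \<noteq> j \<longrightarrow> q l = 0) \<and> q j = 1 \<or> q j = 0 \<and> q 0 - q 1 - q 2 - q 3 = (if j = 0 then -2 else -1)"
  proof (cases "j = 0")
    case True
    have "k = 1 \<or> k = 2 \<or> k = 3" using k(1) cases4[of "\<lambda>x. x = 0 \<or> x = 1 \<or> x = 2 \<or> x = 3" k] by auto
    then show ?thesis
      using d q[of 0] q[of 1] q[of 2] q[of 3] qk True unfolding forall_4' e_def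
      by (elim disjE) simp_all
  next
    case False
    then have "q 0 = 0" using j q0 by simp
    have "k = 1 \<or> k = 2 \<or> k = 3" "j = 1 \<or> j = 2 \<or> j = 3"
      using k(1) False cases4[of "\<lambda>x. x = 0 \<or> x = 1 \<or> x = 2 \<or> x = 3" k]
        cases4[of "\<lambda>x. x = 0 \<or> x = 1 \<or> x = 2 \<or> x = 3" j] by auto
    then show ?thesis
      using d q[of 1] q[of 2] q[of 3] qk k(2) \<open>q 0 = 0\<close> unfolding forall_4' e_def
      by (elim disjE) simp_all
  qed
  then show ?thesis
  proof
    assume "(\<forall>l. l \<noteq> j \<longrightarrow> q l = 0) \<and> q j = 1"
    then show ?thesis using q0 rj by blast
  next
    assume "q j = 0 \<and> q 0 - q 1 - q 2 - q 3 = (if j = 0 then -2 else -1)"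
    moreover from this have "herm (int_vec r) (int_vec r) = (if j = 0 then -2 else -1)"
      unfolding H by (simp split: if_splits)
    ultimately show ?thesis using q0 by blast
  qed
qed

text \<open>The correction \<open>h\<close> fixes the basis vectors in \<open>S\<close> exactly, not
  just modulo \<open>s3\<close>. The columns already in place therefore stay congruent to the
  standard ones while column \<open>j\<close> is added.\<close>

lemma column_step:
  assumes g: "g \<in> G3" and S: "\<And>l. l \<in> S \<Longrightarrow> cong_vec (g *v axis l 1) (axis l 1)"
    and j: "j \<notin> S" "j = 0 \<or> 0 \<in> S" and k: "k \<in> S" "k \<noteq> 0"
  obtains h where "h \<in> G3" "\<And>l. l \<in> S \<Longrightarrow> h *v axis l 1 = axis l 1"
    "\<And>l. l \<in> insert j S \<Longrightarrow> cong_vec ((h ** g) *v axis l 1) (axis l 1)"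
proof -
  obtain r where r: "cong_vec (g *v axis j 1) (int_vec r)" "\<And>l. r l \<in> {-1, 0, 1}"
    "\<And>l. l \<in> S \<Longrightarrow> r l = 0" "cong_s3 (herm (int_vec r) (int_vec r)) (heps j)"
    using column_residue[OF g S j(1)] by blast
  have "\<exists>h\<in>G3. (\<forall>l\<in>S. h *v axis l 1 = axis l 1) \<and> cong_vec (h *v int_vec r) (axis j 1)"
  proof -
    have "k \<noteq> j" using j(1) k(1) by blast
    then consider "\<forall>l. l \<noteq> j \<longrightarrow> r l = 0" "r j = 1" | "\<forall>l. l \<noteq> j \<longrightarrow> r l = 0" "r j = -1"
      | "r j = 0" "herm (int_vec r) (int_vec r) = (if j = 0 then -2 else -1)"
      using residue_cases[OF r(2,4) k(2)] r(3) k(1) j(2) by blast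
    then show ?thesis
    proof cases
      case 1
      then have "int_vec r = axis j 1" using int_vec_axis[of j r] by simp
      then show ?thesis using G3_one by (intro bexI[of _ "mat 1"]) auto
    next
      case 2
      then have "int_vec r = axis j (-1)" using int_vec_axis[of j r] by simp
      moreover obtain h where "h \<in> G3" "\<And>l. l \<noteq> j \<Longrightarrow> h *v axis l 1 = axis l 1" "h *v axis j (-1) = axis j 1"
        using reflection_sign[of j] by blast
      ultimately show ?thesis using j(1) by (metis cong_vec_refl)
    next
      case 3
      then show ?thesis using reflection_move[OF 3(1) r(3) j(1) 3(2)] by metis
    qed
  qed
  then obtain h where h: "h \<in> G3" "\<And>l. l \<in> S \<Longrightarrow> h *v axis l 1 = axis l 1" "cong_vec (h *v int_vec r) (axis j 1)"
    by blast
  have "cong_vec ((h ** g) *v axis l 1) (axis l 1)" if "l \<in> insert j S" for l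
  proof (cases "l = j")
    case True
    then show ?thesis
      using cong_vec_trans[OF cong_vec_G3[OF h(1) r(1)] h(3)] by (simp add: matrix_vector_mul_assoc)
  next
    case False
    then have "l \<in> S" using that by simp
    then show ?thesis
      using cong_vec_G3[OF h(1) S, of l] h(2) by (simp add: matrix_vector_mul_assoc)
  qed
  then show ?thesis using that h by blast
qed

text \<open>Reflections along integral vectors bring the columns of \<open>g\<close> to the standard basis one by one; the
column of index 0 comes first, since only then every residue that can occur is moved by an integral
reflection.\<close>

lemma stabilizer_lift:
  assumes g: "g \<in> G3" and k: "k \<noteq> 0" "cong_vec (g *v axis k 1) (axis k 1)"
  obtains h where "h \<in> G3" "h *v axis k 1 = axis k 1" "h ** g \<in> G3s3"
proof -
  \<comment> \<open>After \<open>k\<close>, the columns are treated in the order 0,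
    \<open>i\<close>, \<open>j\<close>.\<close>
  have "\<exists>i j. UNIV = {k, 0, i, j} \<and> i \<noteq> j \<and> i \<notin> {k, 0} \<and> j \<notin> {k, 0}"
  proof -
    have "k = 1 \<or> k = 2 \<or> k = 3" using k(1) UNIV_4' by auto
    then show ?thesis unfolding UNIV_4'
      by (elim disjE; intro exI[of _ "if k = 1 then 2 else 1"] exI[of _ "if k = 3 then 2 else 3"]) auto
  qed
  then obtain i j where ij: "UNIV = {k, 0, i, j}" "i \<noteq> j" "i \<notin> {k, 0}" "j \<notin> {k, 0}" by blast
  obtain h1 where h1: "h1 \<in> G3" "\<And>l. l \<in> {k} \<Longrightarrow> h1 *v axis l 1 = axis l 1"
    "\<And>l. l \<in> insert 0 {k} \<Longrightarrow> cong_vec ((h1 ** g) *v axis l 1) (axis l 1)"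
    using column_step[of g "{k}" 0 k] g k by auto
  define g1 where "g1 = h1 ** g"
  have g1: "g1 \<in> G3" unfolding g1_def using h1(1) g by (rule G3_mult)
  obtain h2 where h2: "h2 \<in> G3" "\<And>l. l \<in> insert 0 {k} \<Longrightarrow> h2 *v axis l 1 = axis l 1"
    "\<And>l. l \<in> insert i (insert 0 {k}) \<Longrightarrow> cong_vec ((h2 ** g1) *v axis l 1) (axis l 1)"
    using column_step[of g1 "insert 0 {k}" i k] g1 h1(3)[folded g1_def] ij k by auto
  define g2 where "g2 = h2 ** g1"
  have g2: "g2 \<in> G3" unfolding g2_def using h2(1) g1 by (rule G3_mult)
  obtain h3 where h3: "h3 \<in> G3" "\<And>l. l \<in> insert i (insert 0 {k}) \<Longrightarrow> h3 *v axis l 1 = axis l 1"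
    "\<And>l. l \<in> insert j (insert i (insert 0 {k})) \<Longrightarrow> cong_vec ((h3 ** g2) *v axis l 1) (axis l 1)"
    using column_step[of g2 "insert i (insert 0 {k})" j k] g2 h2(3)[folded g2_def] ij k by auto
  define h where "h = h3 ** h2 ** h1"
  have "h \<in> G3" unfolding h_def using h1 h2 h3 by (intro G3_mult)
  moreover have "h *v axis k 1 = axis k 1"
    unfolding h_def using h1(2) h2(2) h3(2) by (simp flip: matrix_vector_mul_assoc)
  moreover have hg: "h ** g = h3 ** g2" by (simp add: h_def g2_def g1_def matrix_mul_assoc)
  have "h ** g \<in> G3s3"
  proof (rule G3s3_columns)
    show "h ** g \<in> G3" unfolding hg using h3(1) g2 by (rule G3_mult)
    fix l' l :: 4
    have "l \<in> insert j (insert i (insert 0 {k}))" using ij(1) by blast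
    then show "cong_s3 (((h ** g) *v axis l 1)$l') ((axis l 1 :: complex^4)$l')"
      using h3(3) unfolding hg cong_vec_def by blast
  qed
  ultimately show ?thesis using that by blast
qed

text \<open>Transitivity provides \<open>g\<close> in the full group taking the basis vector to
  \<open>s *s a\<close>, hence fixing it modulo \<open>s3\<close>. A lift \<open>h\<close> from the
  exact stabilizer makes \<open>h ** g\<close> lie in the kernel; then \<open>g ** h\<close> does as
  well, with the same value on the basis vector.\<close>

lemma G3s3_orbit:
  assumes a: "a \<in> Evec" "herm a a = -1" and k: "k \<noteq> 0" and s: "s \<in> {1, -1}"
    and c: "cong_vec a (axis k s)"
  obtains \<gamma> where "\<gamma> \<in> G3s3" "a = s *s (\<gamma> *v axis k 1)"
proof -
  have "herm (axis k 1) (axis k 1) = -1" using k by (simp add: herm_axis_left heps_def)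
  then have "G3_equiv (axis k 1) (axis 2 1)" by (intro G3_equiv_axis_2) auto
  then have "G3_equiv a (axis k 1)"
    using G3_equiv_axis_2[OF a] G3_equiv_sym G3_equiv_trans by blast
  then obtain g0 where g0: "g0 \<in> G3" "a = g0 *v axis k 1" by (auto simp: G3_equiv_def)
  define g where "g = mat s ** g0"
  have se: "s \<in> Eis" "cmod s = 1" "s * s = 1" using s by auto
  have g: "g \<in> G3" unfolding g_def using scalar_G3[OF se(1,2)] g0(1) by (rule G3_mult)
  have ga: "g *v axis k 1 = s *s a"
    by (simp add: g_def g0(2) mat_scalar_mult flip: matrix_vector_mul_assoc)
  have "s *s axis k s = axis k 1" using se(3) by (simp add: vec_eq_iff axis_def)
  then have "cong_vec (g *v axis k 1) (axis k 1)"
    using cong_vec_scale[OF se(1) c] ga by simp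
  then obtain h where h: "h \<in> G3" "h *v axis k 1 = axis k 1" "h ** g \<in> G3s3"
    using stabilizer_lift[OF g k] by blast
  have "g ** h \<in> G3s3" using G3s3_conjugate[OF g h(1,3)] .
  moreover have "a = s *s ((g ** h) *v axis k 1)"
    using h(2) ga se(3) by (simp flip: matrix_vector_mul_assoc)
  ultimately show ?thesis using that by blast
qed

section \<open>Vanishing on mirrors\<close>

text \<open>The point is sought on the projection to the mirror of the curve \<open>(1, t, t\<^sup>2, t\<^sup>3)\<close>: a nonzero
linear form restricts to a nonzero polynomial in \<open>t\<close>.\<close>

lemma generic_mirror_point:
  assumes a: "herm a a = -1" and B: "countable B"
    and indep: "\<And>b. b \<in> B \<Longrightarrow> b + herm a b *s a \<noteq> 0"
  obtains z where "z \<in> Bt" "herm a z = 0" "\<And>b. b \<in> B \<Longrightarrow> herm b z \<noteq> 0"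
proof -
  define x where "x t = vec4 1 (of_real t) (of_real t ^ 2) (of_real t ^ 3)" for t :: real
  \<comment> \<open>The orthogonal projection of \<open>b\<close> to the complement of
    \<open>a\<close>. Pairing \<open>b\<close> with the projected point equals pairing
    \<open>b' b\<close> with the point of the curve.\<close>
  define b' where "b' b = b + herm a b *s a" for b
  have fin: "finite {t. herm c (x t) = 0}" if "c \<noteq> 0" for c
  proof -
    define p where "p = [:cnj (c$0), - cnj (c$1), - cnj (c$2), - cnj (c$3):]"
    have "p \<noteq> 0" using that unfolding p_def vec_eq_iff forall_4' by auto
    then have "finite {z. poly p z = 0}" by (rule poly_roots_finite)
    then have "finite (of_real -` {z. poly p z = 0} :: real set)"
      by (rule finite_vimageI) (simp add: inj_of_real)
    moreover have "herm c (x t) = poly p (of_real t)" for t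
      unfolding herm_expand x_def p_def by (simp add: algebra_simps power2_eq_square power3_eq_cube)
    ultimately show ?thesis by (simp add: vimage_def)
  qed
  have "countable (\<Union>b\<in>B. {t. herm (b' b) (x t) = 0})"
    using indep by (intro countable_UN[OF B] countable_finite fin) (simp add: b'_def)
  moreover have "uncountable {0<..<1/2::real}" by (simp add: uncountable_open_interval)
  ultimately have "\<not> {0<..<1/2} \<subseteq> (\<Union>b\<in>B. {t. herm (b' b) (x t) = 0})"
    using countable_subset by blast
  then obtain t where "t \<in> {0<..<1/2}" "t \<notin> (\<Union>b\<in>B. {t. herm (b' b) (x t) = 0})"
    by blast
  then have t: "0 < t" "t < 1/2" "\<And>b. b \<in> B \<Longrightarrow> herm (b' b) (x t) \<noteq> 0"
    by auto
  define z where "z = x t + herm a (x t) *s a"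
  have az: "herm a z = 0" unfolding z_def herm_linear a by simp
  \<comment> \<open>Removing the component along the negative vector \<open>a\<close> can only
    increase the norm, so positivity need only be checked on the curve; there \<open>t < 1/2\<close>
    suffices.\<close>
  have "Re (herm z z) = Re (herm (x t) (x t)) + (cmod (herm a (x t)))\<^sup>2"
  proof -
    have "herm z z = herm (x t) (x t) + herm a (x t) * cnj (herm a (x t))"
      unfolding z_def herm_linear a cnj_herm by (simp add: algebra_simps)
    then show ?thesis by (simp flip: complex_norm_square)
  qed
  moreover have "Re (herm (x t) (x t)) > 0"
  proof -
    have "t\<^sup>2 < (1/2)\<^sup>2" using t(1,2) by (intro power_strict_mono) auto
    moreover have "t\<^sup>2 \<le> 1/2" "t ^ 3 \<le> 1/2"
      using t(1,2) power_decreasing[of 1 2 t] power_decreasing[of 1 3 t] by auto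
    then have "(t\<^sup>2)\<^sup>2 \<le> (1/2)\<^sup>2" "(t ^ 3)\<^sup>2 \<le> (1/2)\<^sup>2"
      using t(1) by (intro power_mono; simp)+
    moreover have "Re (herm (x t) (x t)) = 1 - t\<^sup>2 - (t\<^sup>2)\<^sup>2 - (t ^ 3)\<^sup>2"
      unfolding herm_self x_def vec4_nth by (simp add: norm_power)
    ultimately show ?thesis by (simp only: power_divide) simp
  qed
  ultimately have "z \<in> Bt" unfolding Bt_def by (simp add: add_pos_nonneg)
  moreover have "herm b z = herm (b' b) (x t)" for b
    unfolding z_def b'_def herm_linear cnj_herm by simp
  then have "herm b z \<noteq> 0" if "b \<in> B" for b using t(3)[OF that] by simp
  ultimately show ?thesis using that az by blast
qed

text \<open>A vanishing projection makes \<open>b\<close> a multiple of \<open>a\<close>, and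
  equality of the norms forces a multiplier of modulus one.\<close>

lemma proportional_negative:
  assumes a: "herm a a = -1" and b: "herm b b = -1" and ab: "b + herm a b *s a = 0"
  shows "a = (- herm b a) *s b" "cmod (herm b a) = 1"
proof -
  have b_eq: "b = (- herm a b) *s a" using ab by (simp add: vec_eq_iff add_eq_0_iff)
  have "-1 = herm b b" using b by simp
  also have "\<dots> = herm b ((- herm a b) *s a)" by (rule arg_cong[OF b_eq])
  also have "\<dots> = - (herm a b * cnj (herm a b))" unfolding herm_linear cnj_herm by simp
  finally have m: "herm a b * herm b a = 1" unfolding cnj_herm by simp
  then have "of_real ((cmod (herm a b))\<^sup>2) = (1 :: complex)"
    unfolding complex_norm_square cnj_herm .
  then have "(cmod (herm a b))\<^sup>2 = 1" by (simp only: of_real_eq_1_iff)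
  then have "cmod (herm a b) = 1" by (metis abs_norm_cancel abs_square_eq_1)
  then show "cmod (herm b a) = 1" by (metis cnj_herm complex_mod_cnj)
  have "(- herm b a) *s b = (- herm b a) *s ((- herm a b) *s a)" by (rule arg_cong[OF b_eq])
  also have "\<dots> = (herm b a * herm a b) *s a" by (simp add: vec_eq_iff)
  also have "\<dots> = a" by (simp only: mult.commute[of "herm b a"] m vector_smult_lid)
  finally show "a = (- herm b a) *s b" by (rule sym)
qed

text \<open>Residue 0 is impossible, because \<open>cnj u * u = 1\<close> would then be divisible by
  \<open>s3\<close>.\<close>

lemma Eis_unit_residue:
  assumes "u \<in> Eis" "cmod u = 1"
  shows "\<exists>s\<in>{1, -1}. cong_s3 u s"
proof -
  obtain r :: int where r: "r \<in> {-1, 0, 1}" "cong_s3 u (of_int r)" using Eis_residue[OF assms(1)] by blast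
  have "r \<noteq> 0"
  proof
    assume "r = 0"
    then have "cong_s3 (cnj u * u) (cnj u * 0)" using r assms by (intro cong_s3_mult_left) auto
    moreover have "cnj u * u = 1" using assms(2) by (rule unit_cnj_mult)
    ultimately have "cong_s3 (of_int 1) 0" by simp
    then have "3 dvd (1::int)" by (rule cong_s3_of_int_0)
    then show False by simp
  qed
  then show ?thesis using r by auto
qed

lemma vanishing_mirror:
  assumes zeros: "{z \<in> Bt. F z = 0} =
        {\<gamma> *v z | \<gamma> z i. \<gamma> \<in> G3s3 \<and> z \<in> Bt \<and> i \<noteq> 0 \<and> z$i = 0}"
    and a: "a \<in> Evec" "herm a a = -1"
    and van: "\<And>z. z \<in> Bt \<Longrightarrow> herm a z = 0 \<Longrightarrow> F z = 0"
  shows "\<exists>k. \<exists>s\<in>{1, -1}. k \<noteq> 0 \<and> (\<forall>i. cong_s3 (a$i) (axis k s $ i))"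
proof -
  \<comment> \<open>These are the normals of the mirrors in the divisor of \<open>F\<close> that
    differ from the mirror of \<open>a\<close>. A point of the latter avoiding all of them is still
    a zero of \<open>F\<close>, so the mirror it lies on must have a normal proportional to
    \<open>a\<close>.\<close>
  define B where "B = {b. (\<exists>\<gamma>\<in>G3s3. \<exists>i. i \<noteq> 0 \<and> b = \<gamma> *v axis i 1) \<and> b + herm a b *s a \<noteq> 0}"
  have indep: "b + herm a b *s a \<noteq> 0" if "b \<in> B" for b using that unfolding B_def by blast
  have "B \<subseteq> Evec" unfolding B_def by (auto intro!: G3_Evec G3s3_G3)
  then have "countable B" using countable_Evec countable_subset by blast
  then obtain z where z: "z \<in> Bt" "herm a z = 0" "\<And>b. b \<in> B \<Longrightarrow> herm b z \<noteq> 0"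
    using generic_mirror_point[OF a(2), of B] indep by blast
  have "z \<in> {z \<in> Bt. F z = 0}" using van z by blast
  then obtain \<gamma> w i where g: "z = \<gamma> *v w" "\<gamma> \<in> G3s3" "i \<noteq> 0" "w$i = 0"
    unfolding zeros by blast
  define b where "b = \<gamma> *v axis i 1"
  have gG: "\<gamma> \<in> G3" using g(2) by (rule G3s3_G3)
  have "herm b z = 0"
    unfolding b_def g(1) G3_herm[OF gG] herm_axis_left by (simp add: g(4))
  then have "b \<notin> B" using z(3) by blast
  then have ab: "b + herm a b *s a = 0" using g unfolding B_def b_def by blast
  have b: "b \<in> Evec" "herm b b = -1"
    unfolding b_def G3_herm[OF gG] using gG g(3) by (auto simp: G3_Evec herm_axis_left heps_def)
  define u where "u = - herm b a"
  have u: "u \<in> Eis" "cmod u = 1"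
    using proportional_negative(2)[OF a(2) b(2) ab] a(1) b(1) by (auto simp: u_def)
  have ub: "a = u *s b" unfolding u_def by (rule proportional_negative(1)[OF a(2) b(2) ab])
  obtain s where s: "s \<in> {1, -1}" "cong_s3 u s" using Eis_unit_residue[OF u(1,2)] by blast
  have "cong_s3 (a$l) (axis i s $ l)" for l
  proof -
    have "cong_s3 (u * b$l) (s * axis i 1 $ l)"
      unfolding b_def using u(1) s(2) g(2)
      by (intro cong_s3_mult G3s3_cong Evec_axis Evec_nth) auto
    then show ?thesis using ub by (auto simp: axis_def)
  qed
  then show ?thesis using s(1) g(3) by blast
qed

section \<open>First derivatives along and across a mirror\<close>

lemma open_Bt: "open Bt"
proof -
  have "continuous_on UNIV (\<lambda>z. Re (herm z z))"
    unfolding herm_expand by (intro continuous_intros)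
  then show ?thesis unfolding Bt_def
    using open_Collect_less[OF continuous_on_const] by blast
qed

lemma directional_derivative:
  assumes "cderiv_at F p c"
  shows "((\<lambda>t. F (p + complex_of_real t *s x)) has_vector_derivative (\<Sum>j\<in>UNIV. c$j * x$j)) (at 0)"
proof -
  have line: "complex_of_real t *s x = t *\<^sub>R x" for t :: real
    by (simp add: vec_eq_iff scaleR_conv_of_real[where 'a = complex])
  have "((\<lambda>t. p + t *\<^sub>R x) has_vector_derivative x) (at 0)"
    by (auto intro!: derivative_eq_intros)
  moreover have "(F has_derivative (\<lambda>x. \<Sum>j\<in>UNIV. c$j * x$j)) (at ((\<lambda>t. p + t *\<^sub>R x) 0))"
    using assms by (simp add: cderiv_at_def)
  ultimately have "(F \<circ> (\<lambda>t. p + t *\<^sub>R x) has_vector_derivative (\<Sum>j\<in>UNIV. c$j * x$j)) (at 0)"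
    by (rule vector_derivative_diff_chain_within[OF _ has_derivative_at_withinI])
  then show ?thesis by (simp add: line o_def)
qed

lemma Bt_line:
  assumes "p \<in> Bt" obtains T :: "real set" where "open T" "0 \<in> T" "\<And>t. t \<in> T \<Longrightarrow> p + of_real t *s x \<in> Bt"
proof
  have "continuous_on UNIV (\<lambda>t::real. p + t *\<^sub>R x)" by (intro continuous_intros)
  then show "open ((\<lambda>t::real. p + t *\<^sub>R x) -` Bt)" using open_Bt by (rule open_vimage[rotated])
  show "0 \<in> (\<lambda>t::real. p + t *\<^sub>R x) -` Bt" using assms by simp
  show "p + of_real t *s x \<in> Bt" if "t \<in> (\<lambda>t::real. p + t *\<^sub>R x) -` Bt" for t
  proof -
    have "complex_of_real t *s x = t *\<^sub>R x" by (simp add: vec_eq_iff scaleR_conv_of_real[where 'a = complex])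
    then show ?thesis using that by simp
  qed
qed

text \<open>The derivative at \<open>p\<close> kills every direction in the mirror, so being nonzero
  it is nonzero on the normal \<open>a\<close>. The triflection multiplies that direction by
  \<open>zeta\<close>, and the transformation law of \<open>F\<close> multiplies the derivative by
  \<open>v\<close>.\<close>

lemma eigenvalue_from_derivative:
  assumes F: "\<And>z. z \<in> Bt \<Longrightarrow> F (triflection a *v z) = v * F z"
    and a: "herm a a = -1" and p: "p \<in> Bt" "herm a p = 0"
    and van: "\<And>z. z \<in> Bt \<Longrightarrow> herm a z = 0 \<Longrightarrow> F z = 0"
    and c: "cderiv_at F p c" "c \<noteq> 0"
  shows "v = zeta"
proof -
  define L where "L x = (\<Sum>j\<in>UNIV. c$j * x$j)" for x :: "complex^4"
  note D = directional_derivative[OF c(1), folded L_def]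
  have L_add: "L (x + y) = L x + L y" and L_scale: "L (t *s x) = t * L x" for x y t
    unfolding L_def by (simp_all add: algebra_simps sum.distrib sum_distrib_left)
  have tangent: "L x = 0" if x: "herm a x = 0" for x
  proof -
    obtain T :: "real set" where T: "open T" "0 \<in> T" "\<And>t. t \<in> T \<Longrightarrow> p + of_real t *s x \<in> Bt"
      using Bt_line[OF p(1)] by blast
    have "((\<lambda>t::real. 0) has_vector_derivative L x) (at 0)"
    proof (rule has_vector_derivative_transform_within_open[OF D T(1,2)])
      show "F (p + of_real t *s x) = 0" if "t \<in> T" for t
        using van T(3)[OF that] by (simp add: herm_linear p x)
    qed
    then show ?thesis using vector_derivative_unique_at has_vector_derivative_const by blast
  qed
  have normal: "zeta * L a = v * L a"
  proof -
    obtain T :: "real set" where T: "open T" "0 \<in> T" "\<And>t. t \<in> T \<Longrightarrow> p + of_real t *s a \<in> Bt"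
      using Bt_line[OF p(1)] by blast
    have "((\<lambda>t. v * F (p + of_real t *s a)) has_vector_derivative L (zeta *s a)) (at 0)"
    proof (rule has_vector_derivative_transform_within_open[OF D T(1,2)])
      fix t assume "t \<in> T"
      \<comment> \<open>On the normal line through the fixed point \<open>p\<close> the triflection
        rotates the parameter by \<open>zeta\<close>.\<close>
      have "triflection a *v (p + of_real t *s a) = p + of_real t *s (zeta *s a)"
        unfolding triflection_mult[OF a] herm_linear a p(2) by (simp add: vec_eq_iff algebra_simps)
      then show "F (p + of_real t *s (zeta *s a)) = v * F (p + of_real t *s a)"
        using F[OF T(3)[OF \<open>t \<in> T\<close>]] by simp
    qed
    moreover have "((\<lambda>t. v * F (p + of_real t *s a)) has_vector_derivative v * L a) (at 0)"
      using D by (rule has_vector_derivative_mult_right)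
    ultimately have "L (zeta *s a) = v * L a" by (rule vector_derivative_unique_at)
    then show ?thesis by (simp add: L_scale)
  qed
  have "L a \<noteq> 0"
  proof
    assume La: "L a = 0"
    have "L x = 0" for x
    proof -
      have "herm a (x + herm a x *s a) = 0" unfolding herm_linear a by simp
      then have "L (x + herm a x *s a) = 0" by (rule tangent)
      then show ?thesis by (simp add: L_add L_scale La)
    qed
    moreover have "L (axis j 1) = c$j" for j
      unfolding L_def by (simp add: axis_def if_distrib cong: if_cong)
    ultimately have "c = 0" by (simp add: vec_eq_iff)
    then show False using c(2) by simp
  qed
  then show ?thesis using normal by simp
qed

theorem theorem6p2:
  fixes F :: "complex^4 \<Rightarrow> complex" and v :: "complex^4^4 \<Rightarrow> complex"
  assumes mf: "modular_form 1 G3s3 v F"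
    and zeros: "{z \<in> Bt. F z = 0} =
        {\<gamma> *v z | \<gamma> z i. \<gamma> \<in> G3s3 \<and> z \<in> Bt \<and> i \<noteq> 0 \<and> z$i = 0}"
    and mult_one: "\<forall>\<gamma>\<in>G3s3. \<forall>i::4. i \<noteq> 0 \<longrightarrow>
        (\<exists>z\<in>Bt. z$i = 0 \<and> (\<exists>c. cderiv_at F (\<gamma> *v z) c \<and> c \<noteq> 0))"
    and a: "a \<in> Evec" "herm a a = -1"
  shows "v (triflection a) =
     (if \<exists>k::4. \<exists>s\<in>{1::complex, -1}. k \<noteq> 0 \<and> (\<forall>i. cong_s3 (a$i) (axis k s $ i))
      then zeta else 1)"
proof (cases "\<exists>k::4. \<exists>s\<in>{1::complex, -1}. k \<noteq> 0 \<and> (\<forall>i. cong_s3 (a$i) (axis k s $ i))")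
  case True
  then obtain k s where k: "k \<noteq> 0" "s \<in> {1::complex, -1}" "cong_vec a (axis k s)"
    unfolding cong_vec_def by blast
  obtain \<gamma> where g: "\<gamma> \<in> G3s3" "a = s *s (\<gamma> *v axis k 1)" using G3s3_orbit[OF a k] by blast
  have gG: "\<gamma> \<in> G3" using g(1) by (rule G3s3_G3)
  \<comment> \<open>The element \<open>\<gamma>\<close> carries the coordinate mirror of index
    \<open>k\<close> onto the mirror of \<open>a\<close>; the sign \<open>s\<close> does not affect
    it.\<close>
  have mirror: "herm a (\<gamma> *v w) = 0 \<longleftrightarrow> w$k = 0" for w
    unfolding g(2) herm_linear G3_herm[OF gG] herm_axis_left using k by (auto simp: heps_def)
  have van: "F z = 0" if "z \<in> Bt" "herm a z = 0" for z
  proof -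
    obtain \<gamma>' where g': "\<gamma>' \<in> G3" "\<gamma> ** \<gamma>' = mat 1" using G3_inverse[OF gG] by metis
    have z: "z = \<gamma> *v (\<gamma>' *v z)" by (simp add: matrix_vector_mul_assoc g')
    have "(\<gamma>' *v z)$k = 0" using that(2) mirror z by metis
    moreover have "\<gamma>' *v z \<in> Bt" using that(1) g'(1) by (simp add: Bt_G3)
    ultimately have "z \<in> {z \<in> Bt. F z = 0}" unfolding zeros using z g(1) k(1) by blast
    then show ?thesis by simp
  qed
  \<comment> \<open>Multiplicity one supplies a point of this very mirror at which the derivative of
    \<open>F\<close> is nonzero.\<close>
  obtain z c where z: "z \<in> Bt" "z$k = 0" "cderiv_at F (\<gamma> *v z) c" "c \<noteq> 0"
    using mult_one g(1) k(1) by blast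
  have "v (triflection a) = zeta"
  proof (rule eigenvalue_from_derivative[OF _ a(2) _ _ van z(3,4)])
    show "F (triflection a *v w) = v (triflection a) * F w" if "w \<in> Bt" for w
      using mf triflection_G3s3[OF a] that unfolding modular_form_def by blast
  qed (use z gG mirror in \<open>auto simp: Bt_G3\<close>)
  then show ?thesis by (subst if_P[OF True])
next
  case False
  then obtain z where z: "z \<in> Bt" "herm a z = 0" "F z \<noteq> 0"
    using vanishing_mirror[OF zeros a] by blast
  have "F (triflection a *v z) = v (triflection a) * F z"
    using mf triflection_G3s3[OF a] z(1) unfolding modular_form_def by blast
  \<comment> \<open>The point lies on the mirror, hence is fixed, and the nonzero value of
    \<open>F\<close> there can be cancelled.\<close>
  moreover have "triflection a *v z = z" unfolding triflection_mult[OF a(2)] z(2) by simp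
  ultimately have "v (triflection a) = 1" using z(3) by simp
  then show ?thesis by (subst if_not_P[OF False])
qed

end
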